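(* Over $\mathrm{HA}^\omega$, the dependent explicitly controlled product of selection functions $\mathsf{EPS}$ is $T$-definable from the simple explicitly controlled product of selection functions $\mathsf{eps}$; that is, $\mathsf{eps}\geq_T\mathsf{EPS}$.
   Context: Types and systems. Finite types are generated from $\mathbb{B}$ (booleans) and $\mathbb{N}$ by $X\times Y$, $X\to Y$ and $X^*$ (finite sequences). For a sequence of types $(X_i)_{i\in\mathbb{N}}$, $\Pi_i X_i$ is the type of infinite sequences whose $i$-th entry is in $X_i$ and $\Pi_{i<n}X_i$ the type of finite sequences of length $n$. (This is used for readability; one may take all $X_i$ equal to one type $X$, reading $\Pi_iX_i$ as $\mathbb{N}\to X$ and finite sequence types as $X^*$.) $\mathrm{HA}^\omega$ is Heyting arithmetic in all finite types with fully extensional equality (Troelstra's E-$\mathrm{HA}^\omega$); system $T$ is its quantifier-free fragment (Gödel's primitive recursive functionals). $\mathbf{0}$ denotes the canonical zero object of each type (the zero sequence for sequence types, the constant zero function for function types). Notation. $*$ is concatenation; $|s|$ is the length of $s$; $q_x(\alpha)=q(x*\alpha)$. $J_RX=(X\to R)\to X$. $T$-definability. A functional is specified by a defining equation (for each choice of type parameters). $G$ is $T$-definable from $F$ over a theory $\mathcal{S}$ (written $F\ge_T G$) if for each choice of types for $G$ there are a choice of types for $F$ and a term $s$ of system $T$ such that $s(F)$ satisfies the defining equation of $G$, provably in $\mathcal{S}$ together with the defining equation of $F$. $\mathsf{eps}$. For $\varepsilon\colon\Pi_kJ_RX_k$, $\ell\colon R\to\mathbb{N}$, $q\colon\Pi_iX_{i+n}\to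 R$, the value $\mathsf{eps}^\ell_n(\varepsilon)(q)\colon\Pi_iX_{i+n}$ is specified by: $\mathsf{eps}^\ell_n(\varepsilon)(q)=\mathbf{0}$ if $\ell(q(\mathbf{0}))<n$, and otherwise $\mathsf{eps}^\ell_n(\varepsilon)(q)=c*\mathsf{eps}^\ell_{n+1}(\varepsilon)(q_c)$, where $c=\varepsilon_n(\lambda x.\,q_x(\mathsf{eps}^\ell_{n+1}(\varepsilon)(q_x)))$. $\mathsf{EPS}$. For $\varepsilon\colon\Pi_k(\Pi_{i<k}X_i\to J_RX_k)$ (so $\varepsilon_s\colon J_RX_{|s|}$ for a finite sequence $s\colon\Pi_{i<|s|}X_i$), $\ell\colon R\to\mathbb{N}$, $q\colon\Pi_iX_{|s|+i}\to R$, the value $\mathsf{EPS}^\ell_s(\varepsilon)(q)\colon\Pi_iX_{|s|+i}$ is specified by: $\mathsf{EPS}^\ell_s(\varepsilon)(q)=\mathbf{0}$ if $\ell(q(\mathbf{0}))<|s|$, and otherwise $\mathsf{EPS}^\ell_s(\varepsilon)(q)=c*\mathsf{EPS}^\ell_{s*c}(\varepsilon)(q_c)$, where $c=\varepsilon_s(\lambda x.\,q_x(\mathsf{EPS}^\ell_{s*x}(\varepsilon)(q_x)))$. *)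

theory Defs
  imports Main
begin

section \<open>Finite types and the terms of system T\<close>

datatype ty =
    BoolT
  | NatT
  | ProdT ty ty  (infixr "\<otimes>" 70)
  | FunT ty ty   (infixr "\<rightarrow>" 65)
  | SeqT ty

text \<open>
  Finite sequences are generated from the empty sequence by appending an entry on the right
  (\<open>s * x\<close>), so \<open>SeqRec\<close> recurses on the last entry.
\<close>

datatype con =
    TrueC | FalseC | Cond ty
  | ZeroC | SuccC | NatRec ty
  | PairC ty ty | FstC ty ty | SndC ty ty
  | NilC ty | SnocC ty | SeqRec ty ty

primrec con_ty :: "con \<Rightarrow> ty" where
  "con_ty TrueC = BoolT"
| "con_ty FalseC = BoolT"
| "con_ty (Cond \<tau>) = BoolT \<rightarrow> \<tau> \<rightarrow> \<tau> \<rightarrow> \<tau>"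
| "con_ty ZeroC = NatT"
| "con_ty SuccC = NatT \<rightarrow> NatT"
| "con_ty (NatRec \<tau>) = \<tau> \<rightarrow> (NatT \<rightarrow> \<tau> \<rightarrow> \<tau>) \<rightarrow> NatT \<rightarrow> \<tau>"
| "con_ty (PairC \<sigma> \<tau>) = \<sigma> \<rightarrow> \<tau> \<rightarrow> \<sigma> \<otimes> \<tau>"
| "con_ty (FstC \<sigma> \<tau>) = \<sigma> \<otimes> \<tau> \<rightarrow> \<sigma>"
| "con_ty (SndC \<sigma> \<tau>) = \<sigma> \<otimes> \<tau> \<rightarrow> \<tau>"
| "con_ty (NilC \<sigma>) = SeqT \<sigma>"
| "con_ty (SnocC \<sigma>) = SeqT \<sigma> \<rightarrow> \<sigma> \<rightarrow> SeqT \<sigma>"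
| "con_ty (SeqRec \<sigma> \<tau>) = \<tau> \<rightarrow> (SeqT \<sigma> \<rightarrow> \<sigma> \<rightarrow> \<tau> \<rightarrow> \<tau>) \<rightarrow> SeqT \<sigma> \<rightarrow> \<tau>"

text \<open>Variables are de Bruijn indices; a context lists the types of the indices \<open>0, 1, 2, \<dots>\<close>.\<close>

datatype trm =
    Var nat
  | Con con
  | App trm trm  (infixl "\<cdot>" 80)
  | Lam ty trm

inductive has_ty :: "ty list \<Rightarrow> trm \<Rightarrow> ty \<Rightarrow> bool" where
  Var: "i < length \<Delta> \<Longrightarrow> has_ty \<Delta> (Var i) (\<Delta> ! i)"
| Con: "has_ty \<Delta> (Con c) (con_ty c)"
| App: "has_ty \<Delta> s (\<sigma> \<rightarrow> \<tau>) \<Longrightarrow> has_ty \<Delta> t \<sigma> \<Longrightarrow> has_ty \<Delta> (s \<cdot> t) \<tau>"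
| Lam: "has_ty (\<sigma> # \<Delta>) t \<tau> \<Longrightarrow> has_ty \<Delta> (Lam \<sigma> t) (\<sigma> \<rightarrow> \<tau>)"

primrec ren :: "(nat \<Rightarrow> nat) \<Rightarrow> trm \<Rightarrow> trm" where
  "ren \<rho> (Var i) = Var (\<rho> i)"
| "ren \<rho> (Con c) = Con c"
| "ren \<rho> (s \<cdot> t) = ren \<rho> s \<cdot> ren \<rho> t"
| "ren \<rho> (Lam \<sigma> t) = Lam \<sigma> (ren (case_nat 0 (\<lambda>i. Suc (\<rho> i))) t)"

definition up :: "(nat \<Rightarrow> trm) \<Rightarrow> nat \<Rightarrow> trm" where
  "up \<theta> = case_nat (Var 0) (\<lambda>i. ren Suc (\<theta> i))"

text \<open>\<open>sub \<theta>\<close> is simultaneous capture-avoiding substitution of \<open>\<theta> i\<close> for each free index \<open>i\<close>.\<close>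

primrec sub :: "(nat \<Rightarrow> trm) \<Rightarrow> trm \<Rightarrow> trm" where
  "sub \<theta> (Var i) = \<theta> i"
| "sub \<theta> (Con c) = Con c"
| "sub \<theta> (s \<cdot> t) = sub \<theta> s \<cdot> sub \<theta> t"
| "sub \<theta> (Lam \<sigma> t) = Lam \<sigma> (sub (up \<theta>) t)"

text \<open>The instantiation of index \<open>0\<close> by \<open>t\<close>, the other indices being lowered by one.\<close>

definition inst :: "trm \<Rightarrow> nat \<Rightarrow> trm" where
  "inst t = case_nat t Var"


section \<open>Formulas\<close>

datatype fm =
    Eq ty trm trm
  | Bot
  | Conj fm fm
  | Disj fm fm
  | Imp fm fm
  | Forall ty fm
  | Exists ty fm

primrec wff :: "ty list \<Rightarrow> fm \<Rightarrow> bool" where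
  "wff \<Delta> (Eq \<tau> s t) \<longleftrightarrow> has_ty \<Delta> s \<tau> \<and> has_ty \<Delta> t \<tau>"
| "wff \<Delta> Bot \<longleftrightarrow> True"
| "wff \<Delta> (Conj \<phi> \<psi>) \<longleftrightarrow> wff \<Delta> \<phi> \<and> wff \<Delta> \<psi>"
| "wff \<Delta> (Disj \<phi> \<psi>) \<longleftrightarrow> wff \<Delta> \<phi> \<and> wff \<Delta> \<psi>"
| "wff \<Delta> (Imp \<phi> \<psi>) \<longleftrightarrow> wff \<Delta> \<phi> \<and> wff \<Delta> \<psi>"
| "wff \<Delta> (Forall \<tau> \<phi>) \<longleftrightarrow> wff (\<tau> # \<Delta>) \<phi>"
| "wff \<Delta> (Exists \<tau> \<phi>) \<longleftrightarrow> wff (\<tau> # \<Delta>) \<phi>"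

primrec fsub :: "(nat \<Rightarrow> trm) \<Rightarrow> fm \<Rightarrow> fm" where
  "fsub \<theta> (Eq \<tau> s t) = Eq \<tau> (sub \<theta> s) (sub \<theta> t)"
| "fsub \<theta> Bot = Bot"
| "fsub \<theta> (Conj \<phi> \<psi>) = Conj (fsub \<theta> \<phi>) (fsub \<theta> \<psi>)"
| "fsub \<theta> (Disj \<phi> \<psi>) = Disj (fsub \<theta> \<phi>) (fsub \<theta> \<psi>)"
| "fsub \<theta> (Imp \<phi> \<psi>) = Imp (fsub \<theta> \<phi>) (fsub \<theta> \<psi>)"
| "fsub \<theta> (Forall \<tau> \<phi>) = Forall \<tau> (fsub (up \<theta>) \<phi>)"
| "fsub \<theta> (Exists \<tau> \<phi>) = Exists \<tau> (fsub (up \<theta>) \<phi>)"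

definition lift :: "fm \<Rightarrow> fm" where
  "lift \<phi> = fsub (\<lambda>i. Var (Suc i)) \<phi>"

definition close :: "ty list \<Rightarrow> fm \<Rightarrow> fm" where
  "close \<Delta> \<phi> = fold Forall \<Delta> \<phi>"


section \<open>Provability\<close>

text \<open>
  \<open>prv S \<Delta> \<Gamma> \<phi>\<close>: from the assumptions \<open>\<Gamma>\<close>, with free variables typed by \<open>\<Delta>\<close>, the formula \<open>\<phi>\<close> is
  derivable in many-sorted intuitionistic predicate logic with equality at every type and
  \<open>\<beta>\<close>-conversion, using the sentences in \<open>S\<close> as axioms.
\<close>

inductive prv :: "fm set \<Rightarrow> ty list \<Rightarrow> fm set \<Rightarrow> fm \<Rightarrow> bool" for S :: "fm set" where
  asm: "\<phi> \<in> \<Gamma> \<Longrightarrow> wff \<Delta> \<phi> \<Longrightarrow> prv S \<Delta> \<Gamma> \<phi>"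
| ax: "\<phi> \<in> S \<Longrightarrow> wff [] \<phi> \<Longrightarrow> prv S \<Delta> \<Gamma> \<phi>"
| botE: "prv S \<Delta> \<Gamma> Bot \<Longrightarrow> wff \<Delta> \<phi> \<Longrightarrow> prv S \<Delta> \<Gamma> \<phi>"
| conjI: "prv S \<Delta> \<Gamma> \<phi> \<Longrightarrow> prv S \<Delta> \<Gamma> \<psi> \<Longrightarrow> prv S \<Delta> \<Gamma> (Conj \<phi> \<psi>)"
| conjE1: "prv S \<Delta> \<Gamma> (Conj \<phi> \<psi>) \<Longrightarrow> prv S \<Delta> \<Gamma> \<phi>"
| conjE2: "prv S \<Delta> \<Gamma> (Conj \<phi> \<psi>) \<Longrightarrow> prv S \<Delta> \<Gamma> \<psi>"
| disjI1: "prv S \<Delta> \<Gamma> \<phi> \<Longrightarrow> wff \<Delta> \<psi> \<Longrightarrow> prv S \<Delta> \<Gamma> (Disj \<phi> \<psi>)"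
| disjI2: "prv S \<Delta> \<Gamma> \<psi> \<Longrightarrow> wff \<Delta> \<phi> \<Longrightarrow> prv S \<Delta> \<Gamma> (Disj \<phi> \<psi>)"
| disjE: "prv S \<Delta> \<Gamma> (Disj \<phi> \<psi>) \<Longrightarrow> prv S \<Delta> (insert \<phi> \<Gamma>) \<chi> \<Longrightarrow> prv S \<Delta> (insert \<psi> \<Gamma>) \<chi> \<Longrightarrow>
    prv S \<Delta> \<Gamma> \<chi>"
| impI: "wff \<Delta> \<phi> \<Longrightarrow> prv S \<Delta> (insert \<phi> \<Gamma>) \<psi> \<Longrightarrow> prv S \<Delta> \<Gamma> (Imp \<phi> \<psi>)"
| impE: "prv S \<Delta> \<Gamma> (Imp \<phi> \<psi>) \<Longrightarrow> prv S \<Delta> \<Gamma> \<phi> \<Longrightarrow> prv S \<Delta> \<Gamma> \<psi>"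
| allI: "prv S (\<tau> # \<Delta>) (lift ` \<Gamma>) \<phi> \<Longrightarrow> prv S \<Delta> \<Gamma> (Forall \<tau> \<phi>)"
| allE: "prv S \<Delta> \<Gamma> (Forall \<tau> \<phi>) \<Longrightarrow> has_ty \<Delta> t \<tau> \<Longrightarrow> prv S \<Delta> \<Gamma> (fsub (inst t) \<phi>)"
| exI: "wff (\<tau> # \<Delta>) \<phi> \<Longrightarrow> has_ty \<Delta> t \<tau> \<Longrightarrow> prv S \<Delta> \<Gamma> (fsub (inst t) \<phi>) \<Longrightarrow> prv S \<Delta> \<Gamma> (Exists \<tau> \<phi>)"
| exE: "prv S \<Delta> \<Gamma> (Exists \<tau> \<phi>) \<Longrightarrow> wff \<Delta> \<psi> \<Longrightarrow> prv S (\<tau> # \<Delta>) (insert \<phi> (lift ` \<Gamma>)) (lift \<psi>) \<Longrightarrow>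
    prv S \<Delta> \<Gamma> \<psi>"
| refl: "has_ty \<Delta> t \<tau> \<Longrightarrow> prv S \<Delta> \<Gamma> (Eq \<tau> t t)"
| subst: "wff (\<tau> # \<Delta>) \<phi> \<Longrightarrow> prv S \<Delta> \<Gamma> (Eq \<tau> s t) \<Longrightarrow> prv S \<Delta> \<Gamma> (fsub (inst s) \<phi>) \<Longrightarrow>
    prv S \<Delta> \<Gamma> (fsub (inst t) \<phi>)"
| beta: "has_ty (\<sigma> # \<Delta>) t \<tau> \<Longrightarrow> has_ty \<Delta> s \<sigma> \<Longrightarrow> prv S \<Delta> \<Gamma> (Eq \<tau> (Lam \<sigma> t \<cdot> s) (sub (inst s) t))"


section \<open>Heyting arithmetic in all finite types\<close>

text \<open>
  The non-logical axioms of extensional Heyting arithmetic in all finite types; distinctness and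
  injectivity of the remaining constructors are derivable by means of \<open>Cond\<close>, the projections
  and \<open>SeqRec\<close>.
\<close>

inductive_set HA_omega :: "fm set" where
  ext: "Forall (\<sigma> \<rightarrow> \<tau>) (Forall (\<sigma> \<rightarrow> \<tau>)
      (Imp (Forall \<sigma> (Eq \<tau> (Var 2 \<cdot> Var 0) (Var 1 \<cdot> Var 0))) (Eq (\<sigma> \<rightarrow> \<tau>) (Var 1) (Var 0)))) \<in> HA_omega"
| cond_true: "Forall \<tau> (Forall \<tau> (Eq \<tau> (Con (Cond \<tau>) \<cdot> Con TrueC \<cdot> Var 1 \<cdot> Var 0) (Var 1))) \<in> HA_omega"
| cond_false: "Forall \<tau> (Forall \<tau> (Eq \<tau> (Con (Cond \<tau>) \<cdot> Con FalseC \<cdot> Var 1 \<cdot> Var 0) (Var 0))) \<in> HA_omega"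
| bool_ind: "wff (BoolT # \<Delta>) \<phi> \<Longrightarrow>
    close \<Delta> (Imp (fsub (inst (Con TrueC)) \<phi>) (Imp (fsub (inst (Con FalseC)) \<phi>) (Forall BoolT \<phi>)))
      \<in> HA_omega"
| succ_nonzero: "Forall NatT (Imp (Eq NatT (Con SuccC \<cdot> Var 0) (Con ZeroC)) Bot) \<in> HA_omega"
| succ_inj: "Forall NatT (Forall NatT
    (Imp (Eq NatT (Con SuccC \<cdot> Var 1) (Con SuccC \<cdot> Var 0)) (Eq NatT (Var 1) (Var 0)))) \<in> HA_omega"
| nat_rec_zero: "Forall \<tau> (Forall (NatT \<rightarrow> \<tau> \<rightarrow> \<tau>)
    (Eq \<tau> (Con (NatRec \<tau>) \<cdot> Var 1 \<cdot> Var 0 \<cdot> Con ZeroC) (Var 1))) \<in> HA_omega"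
| nat_rec_succ: "Forall \<tau> (Forall (NatT \<rightarrow> \<tau> \<rightarrow> \<tau>) (Forall NatT
    (Eq \<tau> (Con (NatRec \<tau>) \<cdot> Var 2 \<cdot> Var 1 \<cdot> (Con SuccC \<cdot> Var 0))
      (Var 1 \<cdot> Var 0 \<cdot> (Con (NatRec \<tau>) \<cdot> Var 2 \<cdot> Var 1 \<cdot> Var 0))))) \<in> HA_omega"
| nat_ind: "wff (NatT # \<Delta>) \<phi> \<Longrightarrow>
    close \<Delta> (Imp (fsub (inst (Con ZeroC)) \<phi>)
      (Imp (Forall NatT (Imp \<phi> (fsub (case_nat (Con SuccC \<cdot> Var 0) (\<lambda>i. Var (Suc i))) \<phi>)))
        (Forall NatT \<phi>))) \<in> HA_omega"
| fst_pair: "Forall \<sigma> (Forall \<tau> (Eq \<sigma> (Con (FstC \<sigma> \<tau>) \<cdot> (Con (PairC \<sigma> \<tau>) \<cdot> Var 1 \<cdot> Var 0)) (Var 1)))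
    \<in> HA_omega"
| snd_pair: "Forall \<sigma> (Forall \<tau> (Eq \<tau> (Con (SndC \<sigma> \<tau>) \<cdot> (Con (PairC \<sigma> \<tau>) \<cdot> Var 1 \<cdot> Var 0)) (Var 0)))
    \<in> HA_omega"
| pair_surj: "Forall (\<sigma> \<otimes> \<tau>) (Eq (\<sigma> \<otimes> \<tau>)
    (Con (PairC \<sigma> \<tau>) \<cdot> (Con (FstC \<sigma> \<tau>) \<cdot> Var 0) \<cdot> (Con (SndC \<sigma> \<tau>) \<cdot> Var 0)) (Var 0)) \<in> HA_omega"
| seq_rec_nil: "Forall \<tau> (Forall (SeqT \<sigma> \<rightarrow> \<sigma> \<rightarrow> \<tau> \<rightarrow> \<tau>)
    (Eq \<tau> (Con (SeqRec \<sigma> \<tau>) \<cdot> Var 1 \<cdot> Var 0 \<cdot> Con (NilC \<sigma>)) (Var 1))) \<in> HA_omega"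
| seq_rec_snoc: "Forall \<tau> (Forall (SeqT \<sigma> \<rightarrow> \<sigma> \<rightarrow> \<tau> \<rightarrow> \<tau>) (Forall (SeqT \<sigma>) (Forall \<sigma>
    (Eq \<tau> (Con (SeqRec \<sigma> \<tau>) \<cdot> Var 3 \<cdot> Var 2 \<cdot> (Con (SnocC \<sigma>) \<cdot> Var 1 \<cdot> Var 0))
      (Var 2 \<cdot> Var 1 \<cdot> Var 0 \<cdot> (Con (SeqRec \<sigma> \<tau>) \<cdot> Var 3 \<cdot> Var 2 \<cdot> Var 1)))))) \<in> HA_omega"
| seq_ind: "wff (SeqT \<sigma> # \<Delta>) \<phi> \<Longrightarrow>
    close \<Delta> (Imp (fsub (inst (Con (NilC \<sigma>))) \<phi>)
      (Imp (Forall (SeqT \<sigma>) (Forall \<sigma>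
          (Imp (fsub (case_nat (Var 1) (\<lambda>i. Var (i + 2))) \<phi>)
            (fsub (case_nat (Con (SnocC \<sigma>) \<cdot> Var 1 \<cdot> Var 0) (\<lambda>i. Var (i + 2))) \<phi>))))
        (Forall (SeqT \<sigma>) \<phi>))) \<in> HA_omega"


section \<open>T-definability\<close>

text \<open>
  A specification is the type of a functional and its defining equation, a formula whose only
  free variable is index \<open>0\<close>, standing for the functional. A functional with type
  parameters in \<open>'p\<close> is given by a specification for each choice of parameters.
\<close>

type_synonym spec = "ty \<times> fm"

text \<open>
  \<open>F\<close> is represented by a free variable, not generalised over, about which only
  its defining equation is assumed; hence it plays the role of a new constant.
\<close>

definition T_definable_from :: "fm set \<Rightarrow> ('p \<Rightarrow> spec) \<Rightarrow> ('q \<Rightarrow> spec) \<Rightarrow> bool" where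
  "T_definable_from S F G \<longleftrightarrow>
    (\<forall>q. \<exists>p s. has_ty [] s (fst (F p) \<rightarrow> fst (G q)) \<and>
      prv S [fst (F p)] {snd (F p)} (fsub (inst (s \<cdot> Var 0)) (snd (G q))))"


section \<open>Auxiliary closed terms\<close>

primrec zero :: "ty \<Rightarrow> trm" where
  "zero BoolT = Con FalseC"
| "zero NatT = Con ZeroC"
| "zero (\<sigma> \<otimes> \<tau>) = Con (PairC \<sigma> \<tau>) \<cdot> zero \<sigma> \<cdot> zero \<tau>"
| "zero (\<sigma> \<rightarrow> \<tau>) = Lam \<sigma> (zero \<tau>)"
| "zero (SeqT \<sigma>) = Con (NilC \<sigma>)"

definition predec :: trm where
  "predec = Lam NatT (Con (NatRec NatT) \<cdot> Con ZeroC \<cdot> Lam NatT (Lam NatT (Var 1)) \<cdot> Var 0)"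

text \<open>\<open>monus \<cdot> m \<cdot> n\<close> is truncated subtraction of \<open>n\<close> from \<open>m\<close>.\<close>

definition monus :: trm where
  "monus = Lam NatT (Lam NatT
    (Con (NatRec NatT) \<cdot> Var 1 \<cdot> Lam NatT (Lam NatT (predec \<cdot> Var 0)) \<cdot> Var 0))"

definition positive :: trm where
  "positive = Lam NatT (Con (NatRec BoolT) \<cdot> Con FalseC \<cdot> Lam NatT (Lam BoolT (Con TrueC)) \<cdot> Var 0)"

text \<open>The characteristic function of \<open>m < n\<close>.\<close>

definition lessb :: trm where
  "lessb = Lam NatT (Lam NatT (positive \<cdot> (monus \<cdot> Var 0 \<cdot> Var 1)))"

definition len :: "ty \<Rightarrow> trm" where
  "len X = Con (SeqRec X NatT) \<cdot> Con ZeroC \<cdot> Lam (SeqT X) (Lam X (Lam NatT (Con SuccC \<cdot> Var 0)))"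

text \<open>\<open>cons X \<cdot> x \<cdot> \<alpha>\<close> is the infinite sequence \<open>x * \<alpha>\<close>.\<close>

definition cons :: "ty \<Rightarrow> trm" where
  "cons X = Lam X (Lam (NatT \<rightarrow> X) (Lam NatT
    (Con (NatRec X) \<cdot> Var 2 \<cdot> Lam NatT (Lam X (Var 3 \<cdot> Var 1)) \<cdot> Var 0)))"

text \<open>\<open>after X R \<cdot> q \<cdot> x\<close> is \<open>q\<^sub>x = (\<lambda>\<alpha>. q (x * \<alpha>))\<close>.\<close>

definition after :: "ty \<Rightarrow> ty \<Rightarrow> trm" where
  "after X R = Lam ((NatT \<rightarrow> X) \<rightarrow> R) (Lam X (Lam (NatT \<rightarrow> X)
    (Var 2 \<cdot> (cons X \<cdot> Var 1 \<cdot> Var 0))))"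


section \<open>The explicitly controlled products of selection functions\<close>

definition J :: "ty \<Rightarrow> ty \<Rightarrow> ty" where
  "J R X = (X \<rightarrow> R) \<rightarrow> X"

text \<open>
  Forall entry types \<open>X\<^sub>i\<close> are one type \<open>X\<close>, so infinite sequences have type \<open>NatT \<rightarrow> X\<close> and
  finite sequences have type \<open>SeqT X\<close>. The type parameters are the pairs \<open>(X, R)\<close>. The product
  takes its arguments in the order \<open>\<ell>\<close>, \<open>n\<close> (or \<open>s\<close>), \<open>\<epsilon>\<close>, \<open>q\<close>. In the
  equations \<open>f\<close> is the functional itself, and primed names are the same variables
  under the binder \<open>\<lambda>x\<close>.
\<close>

definition eps_ty :: "ty \<Rightarrow> ty \<Rightarrow> ty" where
  "eps_ty X R =
    (R \<rightarrow> NatT) \<rightarrow> NatT \<rightarrow> (NatT \<rightarrow> J R X) \<rightarrow> ((NatT \<rightarrow> X) \<rightarrow> R) \<rightarrow> (NatT \<rightarrow> X)"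

definition eps_eq :: "ty \<Rightarrow> ty \<Rightarrow> fm" where
  "eps_eq X R =
    Forall (R \<rightarrow> NatT) (Forall NatT (Forall (NatT \<rightarrow> J R X) (Forall ((NatT \<rightarrow> X) \<rightarrow> R)
      (let f = Var 4; l = Var 3; n = Var 2; e = Var 1; q = Var 0;
           f' = Var 5; l' = Var 4; n' = Var 3; e' = Var 2; q' = Var 1; x = Var 0;
           q'x = after X R \<cdot> q' \<cdot> x;
           c = e \<cdot> n \<cdot> Lam X (q'x \<cdot> (f' \<cdot> l' \<cdot> (Con SuccC \<cdot> n') \<cdot> e' \<cdot> q'x))
       in Eq (NatT \<rightarrow> X) (f \<cdot> l \<cdot> n \<cdot> e \<cdot> q)
            (Con (Cond (NatT \<rightarrow> X)) \<cdot> (lessb \<cdot> (l \<cdot> (q \<cdot> zero (NatT \<rightarrow> X))) \<cdot> n)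
              \<cdot> zero (NatT \<rightarrow> X)
              \<cdot> (cons X \<cdot> c \<cdot> (f \<cdot> l \<cdot> (Con SuccC \<cdot> n) \<cdot> e \<cdot> (after X R \<cdot> q \<cdot> c))))))))"

definition EPS_ty :: "ty \<Rightarrow> ty \<Rightarrow> ty" where
  "EPS_ty X R =
    (R \<rightarrow> NatT) \<rightarrow> SeqT X \<rightarrow> (SeqT X \<rightarrow> J R X) \<rightarrow> ((NatT \<rightarrow> X) \<rightarrow> R) \<rightarrow> (NatT \<rightarrow> X)"

definition EPS_eq :: "ty \<Rightarrow> ty \<Rightarrow> fm" where
  "EPS_eq X R =
    Forall (R \<rightarrow> NatT) (Forall (SeqT X) (Forall (SeqT X \<rightarrow> J R X) (Forall ((NatT \<rightarrow> X) \<rightarrow> R)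
      (let f = Var 4; l = Var 3; s = Var 2; e = Var 1; q = Var 0;
           f' = Var 5; l' = Var 4; s' = Var 3; e' = Var 2; q' = Var 1; x = Var 0;
           q'x = after X R \<cdot> q' \<cdot> x;
           c = e \<cdot> s \<cdot> Lam X (q'x \<cdot> (f' \<cdot> l' \<cdot> (Con (SnocC X) \<cdot> s' \<cdot> x) \<cdot> e' \<cdot> q'x))
       in Eq (NatT \<rightarrow> X) (f \<cdot> l \<cdot> s \<cdot> e \<cdot> q)
            (Con (Cond (NatT \<rightarrow> X)) \<cdot> (lessb \<cdot> (l \<cdot> (q \<cdot> zero (NatT \<rightarrow> X))) \<cdot> (len X \<cdot> s))
              \<cdot> zero (NatT \<rightarrow> X)
              \<cdot> (cons X \<cdot> c \<cdot> (f \<cdot> l \<cdot> (Con (SnocC X) \<cdot> s \<cdot> c) \<cdot> e \<cdot> (after X R \<cdot> q \<cdot> c))))))))"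

definition eps :: "ty \<times> ty \<Rightarrow> spec" where
  "eps = (\<lambda>(X, R). (eps_ty X R, eps_eq X R))"

definition EPS :: "ty \<times> ty \<Rightarrow> spec" where
  "EPS = (\<lambda>(X, R). (EPS_ty X R, EPS_eq X R))"

end

theory Submission
  imports Defs
begin

text \<open>
  Apply \<open>eps\<close> to the type \<open>Y = X\<^sup>* \<rightarrow> X\<close> of strategies. Starting from a history \<open>s\<close>, a sequence \<open>\<alpha>\<close> of
  strategies determines a play \<open>\<alpha>\<^sup>s\<close>, and \<open>(y * \<alpha>)\<^sup>s = y(s) * \<alpha>\<^bsup>s * y(s)\<^esup>\<close>. Put
  \<open>q\<^sup>s(\<alpha>) = q(\<alpha>\<^sup>s)\<close> and \<open>\<epsilon>'\<^sub>n(p)(t) = \<epsilon>\<^sub>t(\<lambda>x. p(\<lambda>_. x))\<close>. Then \<open>EPS\<^sub>s(\<epsilon>)(q)\<close> may be taken to be the play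
  from \<open>s\<close> of \<open>eps\<^sub>n(\<epsilon>')(q\<^sup>s)\<close> with \<open>n = |s|\<close>: since \<open>(q\<^sup>s)\<^sub>y = (q\<^bsub>y(s)\<^esub>)\<^bsup>s * y(s)\<^esup>\<close>, unfolding the
  equation of \<open>eps\<close> once already gives the equation of \<open>EPS\<close>, and induction is needed only for
  the law of plays.
\<close>

section \<open>Type inference and substitution\<close>

primrec infer :: "trm \<Rightarrow> ty list \<Rightarrow> ty option" where
  "infer (Var i) \<Delta> = (if i < length \<Delta> then Some (\<Delta> ! i) else None)"
| "infer (Con c) \<Delta> = Some (con_ty c)"
| "infer (s \<cdot> t) \<Delta> = (case infer s \<Delta> of
      Some (\<sigma> \<rightarrow> \<tau>) \<Rightarrow> if infer t \<Delta> = Some \<sigma> then Some \<tau> else None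
    | _ \<Rightarrow> None)"
| "infer (Lam \<sigma> t) \<Delta> = map_option (FunT \<sigma>) (infer t (\<sigma> # \<Delta>))"

lemma has_ty_imp_infer: "has_ty \<Delta> t \<tau> \<Longrightarrow> infer t \<Delta> = Some \<tau>"
  by (induction rule: has_ty.induct) simp_all

lemma infer_imp_has_ty: "infer t \<Delta> = Some \<tau> \<Longrightarrow> has_ty \<Delta> t \<tau>"
proof (induction t arbitrary: \<Delta> \<tau>)
  case (App s t)
  then obtain \<sigma> where "infer s \<Delta> = Some (\<sigma> \<rightarrow> \<tau>)" "infer t \<Delta> = Some \<sigma>"
    by (auto split: if_splits option.splits ty.splits)
  with App.IH show ?case by (blast intro: has_ty.App)
qed (auto intro: has_ty.Var has_ty.Con has_ty.Lam split: if_splits)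

lemma has_ty_iff_infer: "has_ty \<Delta> t \<tau> \<longleftrightarrow> infer t \<Delta> = Some \<tau>"
  using has_ty_imp_infer infer_imp_has_ty by blast

lemma has_ty_App_iff: "has_ty \<Delta> (s \<cdot> t) \<tau> \<longleftrightarrow> (\<exists>\<sigma>. has_ty \<Delta> s (\<sigma> \<rightarrow> \<tau>) \<and> has_ty \<Delta> t \<sigma>)"
  by (auto simp: has_ty_iff_infer split: option.splits ty.splits if_splits)

lemma has_ty_ren:
  assumes "has_ty \<Delta> t \<tau>" "\<And>i. i < length \<Delta> \<Longrightarrow> \<rho> i < length \<Delta>' \<and> \<Delta>' ! \<rho> i = \<Delta> ! i"
  shows "has_ty \<Delta>' (ren \<rho> t) \<tau>"
  using assms
proof (induction arbitrary: \<rho> \<Delta>' rule: has_ty.induct)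
  case (Var i \<Delta>)
  then show ?case using has_ty.Var[of "\<rho> i" \<Delta>'] by simp
next
  case (App \<Delta> s \<sigma> \<tau> t)
  have "has_ty \<Delta>' (ren \<rho> s) (\<sigma> \<rightarrow> \<tau>)" "has_ty \<Delta>' (ren \<rho> t) \<sigma>"
    using App by blast+
  then show ?case by (auto intro: has_ty.App)
next
  case (Lam \<sigma> \<Delta> t \<tau>)
  show ?case
    by (auto intro!: has_ty.Lam Lam.IH simp: Lam.prems less_Suc_eq_0_disj split: nat.splits)
qed (auto intro: has_ty.Con)

lemma infer_ren_Suc [simp]: "infer t \<Delta> = Some \<tau> \<Longrightarrow> infer (ren Suc t) (\<sigma> # \<Delta>) = Some \<tau>"
  using has_ty_ren[of \<Delta> t \<tau> Suc "\<sigma> # \<Delta>"] by (simp add: has_ty_iff_infer)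

lemma up_simps [simp]: "up \<theta> 0 = Var 0" "up \<theta> (Suc i) = ren Suc (\<theta> i)"
  by (simp_all add: up_def)

lemma up_numeral [simp]: "up \<theta> (numeral k) = ren Suc (\<theta> (pred_numeral k))"
  by (simp add: numeral_eq_Suc)

lemma inst_simps [simp]: "inst t 0 = t" "inst t (Suc i) = Var i"
  by (simp_all add: inst_def)

definition typed_sub :: "ty list \<Rightarrow> (nat \<Rightarrow> trm) \<Rightarrow> ty list \<Rightarrow> bool" where
  "typed_sub \<Delta>' \<theta> \<Delta> \<longleftrightarrow> (\<forall>i < length \<Delta>. has_ty \<Delta>' (\<theta> i) (\<Delta> ! i))"

lemma typed_sub_up: "typed_sub \<Delta>' \<theta> \<Delta> \<Longrightarrow> typed_sub (\<sigma> # \<Delta>') (up \<theta>) (\<sigma> # \<Delta>)"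
  by (auto simp: typed_sub_def has_ty_iff_infer less_Suc_eq_0_disj)

lemma has_ty_sub: "has_ty \<Delta> t \<tau> \<Longrightarrow> typed_sub \<Delta>' \<theta> \<Delta> \<Longrightarrow> has_ty \<Delta>' (sub \<theta> t) \<tau>"
proof (induction arbitrary: \<theta> \<Delta>' rule: has_ty.induct)
  case (Lam \<sigma> \<Delta> t \<tau>)
  then show ?case by (auto intro!: has_ty.Lam typed_sub_up)
next
  case (App \<Delta> s \<sigma> \<tau> t)
  have "has_ty \<Delta>' (sub \<theta> s) (\<sigma> \<rightarrow> \<tau>)" "has_ty \<Delta>' (sub \<theta> t) \<sigma>"
    using App by blast+
  then show ?case by (auto intro: has_ty.App)
qed (auto simp: typed_sub_def intro: has_ty.Con)

lemma wff_fsub: "wff \<Delta> \<phi> \<Longrightarrow> typed_sub \<Delta>' \<theta> \<Delta> \<Longrightarrow> wff \<Delta>' (fsub \<theta> \<phi>)"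
  by (induction \<phi> arbitrary: \<theta> \<Delta> \<Delta>') (auto intro: has_ty_sub typed_sub_up)

lemma typed_sub_inst: "has_ty \<Delta> t \<tau> \<Longrightarrow> typed_sub \<Delta> (inst t) (\<tau> # \<Delta>)"
  by (auto simp: typed_sub_def has_ty_iff_infer less_Suc_eq_0_disj)

lemma typed_sub_Var: "typed_sub \<Delta> Var \<Delta>"
  by (simp add: typed_sub_def has_ty_iff_infer)

lemma typed_sub_Nil [simp]: "typed_sub \<Delta> \<theta> []"
  by (simp add: typed_sub_def)

lemma typed_sub_Cons [simp]:
  "typed_sub \<Delta>' \<theta> (\<tau> # \<Delta>) \<longleftrightarrow> has_ty \<Delta>' (\<theta> 0) \<tau> \<and> typed_sub \<Delta>' (\<lambda>i. \<theta> (Suc i)) \<Delta>"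
  by (simp add: typed_sub_def All_less_Suc2)

lemma ren_eq_sub: "ren \<rho> t = sub (\<lambda>i. Var (\<rho> i)) t"
proof (induction t arbitrary: \<rho>)
  case (Lam \<sigma> t)
  have "up (\<lambda>i. Var (\<rho> i)) = (\<lambda>i. Var (case_nat 0 (\<lambda>i. Suc (\<rho> i)) i))"
    by (rule HOL.ext) (simp add: up_def split: nat.split)
  then show ?case by (simp add: Lam)
qed simp_all

lemma sub_ren: "sub \<theta> (ren \<rho> t) = sub (\<lambda>i. \<theta> (\<rho> i)) t"
proof (induction t arbitrary: \<theta> \<rho>)
  case (Lam \<sigma> t)
  have "(\<lambda>i. up \<theta> (case_nat 0 (\<lambda>i. Suc (\<rho> i)) i)) = up (\<lambda>i. \<theta> (\<rho> i))"
    by (rule HOL.ext) (simp add: up_def split: nat.split)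
  then show ?case by (simp add: Lam)
qed simp_all

lemma ren_ren: "ren \<rho>' (ren \<rho> t) = ren (\<lambda>i. \<rho>' (\<rho> i)) t"
  by (simp add: ren_eq_sub sub_ren[unfolded ren_eq_sub])

lemma ren_sub: "ren \<rho> (sub \<theta> t) = sub (\<lambda>i. ren \<rho> (\<theta> i)) t"
proof (induction t arbitrary: \<theta> \<rho>)
  case (Lam \<sigma> t)
  have "(\<lambda>i. ren (case_nat 0 (\<lambda>i. Suc (\<rho> i))) (up \<theta> i)) = up (\<lambda>i. ren \<rho> (\<theta> i))"
    by (rule HOL.ext) (simp add: up_def ren_ren split: nat.split)
  then show ?case by (simp add: Lam)
qed simp_all

lemma up_comp: "(\<lambda>i. sub (up \<theta>') (up \<theta> i)) = up (\<lambda>i. sub \<theta>' (\<theta> i))"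
  by (rule HOL.ext) (simp add: up_def sub_ren ren_sub split: nat.split)

lemma sub_sub: "sub \<theta>' (sub \<theta> t) = sub (\<lambda>i. sub \<theta>' (\<theta> i)) t"
  by (induction t arbitrary: \<theta> \<theta>') (simp_all add: up_comp)

lemma fsub_fsub: "fsub \<theta>' (fsub \<theta> \<phi>) = fsub (\<lambda>i. sub \<theta>' (\<theta> i)) \<phi>"
  by (induction \<phi> arbitrary: \<theta> \<theta>') (simp_all add: up_comp sub_sub)

lemma up_Var [simp]: "up Var = Var"
  by (rule HOL.ext) (simp add: up_def split: nat.split)

lemma sub_Var [simp]: "sub Var t = t"
  by (induction t) simp_all

lemma fsub_Var [simp]: "fsub Var \<phi> = \<phi>"
  by (induction \<phi>) simp_all

lemma sub_ident: "has_ty \<Delta> t \<tau> \<Longrightarrow> (\<And>i. i < length \<Delta> \<Longrightarrow> \<theta> i = Var i) \<Longrightarrow> sub \<theta> t = t"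
proof (induction arbitrary: \<theta> rule: has_ty.induct)
  case (Lam \<sigma> \<Delta> t \<tau>)
  then show ?case by (auto simp: up_def split: nat.splits)
qed auto

lemma fsub_ident: "wff \<Delta> \<phi> \<Longrightarrow> (\<And>i. i < length \<Delta> \<Longrightarrow> \<theta> i = Var i) \<Longrightarrow> fsub \<theta> \<phi> = \<phi>"
proof (induction \<phi> arbitrary: \<theta> \<Delta>)
  case (Forall \<tau> \<phi>)
  show ?case
    using Forall.prems by (auto intro!: Forall.IH[of "\<tau> # \<Delta>"] simp: up_def split: nat.splits)
next
  case (Exists \<tau> \<phi>)
  show ?case
    using Exists.prems by (auto intro!: Exists.IH[of "\<tau> # \<Delta>"] simp: up_def split: nat.splits)
qed (auto intro: sub_ident)

lemma sub_inst_ren_Suc [simp]: "sub (inst s) (ren Suc t) = t"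
  by (simp add: sub_ren)

lemma sub_case_nat_ren_Suc [simp]: "sub (case_nat s \<theta>) (ren Suc t) = sub \<theta> t"
  by (simp add: sub_ren)

lemma sub_up_ren_Suc [simp]: "sub (up \<theta>) (ren Suc t) = ren Suc (sub \<theta> t)"
  by (simp add: sub_ren ren_sub)

lemma lift_fsub: "lift (fsub \<theta> \<phi>) = fsub (\<lambda>i. ren Suc (\<theta> i)) \<phi>"
  by (simp add: lift_def fsub_fsub ren_eq_sub)

section \<open>Derived rules\<close>

lemma prv_wff: "prv S \<Delta> \<Gamma> \<phi> \<Longrightarrow> wff \<Delta> \<phi>"
proof (induction rule: prv.induct)
  case (ax \<phi> \<Delta> \<Gamma>)
  then show ?case using wff_fsub[of "[]" \<phi> \<Delta> Var] by simp
next
  case (allE \<Delta> \<Gamma> \<tau> \<phi> t)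
  then show ?case by (auto intro: wff_fsub typed_sub_inst)
next
  case (subst \<tau> \<Delta> \<phi> \<Gamma> s t)
  then show ?case by (auto intro: wff_fsub typed_sub_inst)
next
  case (beta \<sigma> \<Delta> t \<tau> s \<Gamma>)
  then show ?case by (auto intro: has_ty.intros has_ty_sub typed_sub_inst)
qed auto

lemma prv_close_instance:
  assumes "prv S \<Delta>' \<Gamma> (fsub \<theta>' (close \<Delta> \<phi>))" "typed_sub \<Delta>' \<theta> \<Delta>"
    "\<And>i. \<theta> (i + length \<Delta>) = \<theta>' i"
  shows "prv S \<Delta>' \<Gamma> (fsub \<theta> \<phi>)"
  using assms
proof (induction \<Delta> arbitrary: \<phi> \<theta>)
  case Nil
  then have "\<theta> = \<theta>'" by auto
  with Nil show ?case by (simp add: close_def)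
next
  case (Cons \<tau> \<Delta>)
  let ?\<theta> = "\<lambda>i. \<theta> (Suc i)"
  have ty: "has_ty \<Delta>' (\<theta> 0) \<tau>" "typed_sub \<Delta>' ?\<theta> \<Delta>"
    using Cons.prems(2) by simp_all
  have "prv S \<Delta>' \<Gamma> (fsub \<theta>' (close \<Delta> (Forall \<tau> \<phi>)))"
    using Cons.prems(1) by (simp add: close_def)
  moreover have "?\<theta> (i + length \<Delta>) = \<theta>' i" for i
    using Cons.prems(3)[of i] by simp
  ultimately have "prv S \<Delta>' \<Gamma> (fsub ?\<theta> (Forall \<tau> \<phi>))"
    by (rule Cons.IH[OF _ ty(2)])
  then have "prv S \<Delta>' \<Gamma> (fsub (inst (\<theta> 0)) (fsub (up ?\<theta>) \<phi>))"
    using ty(1) by (auto intro: prv.allE)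
  moreover have "(\<lambda>i. sub (inst (\<theta> 0)) (up ?\<theta> i)) = \<theta>"
    by (rule HOL.ext) (simp add: up_def split: nat.split)
  ultimately show ?case by (simp add: fsub_fsub)
qed

lemma wff_close: "wff \<Delta> (fold Forall \<Delta>' \<phi>) \<longleftrightarrow> wff (\<Delta>' @ \<Delta>) \<phi>"
  by (induction \<Delta>' arbitrary: \<phi>) auto

lemma ax_instance:
  assumes "close \<Delta> \<phi> \<in> S" "wff \<Delta> \<phi>" "typed_sub \<Delta>' \<theta> \<Delta>"
  shows "prv S \<Delta>' \<Gamma> (fsub \<theta> \<phi>)"
proof -
  have "wff [] (close \<Delta> \<phi>)"
    using assms(2) wff_close[of "[]" \<Delta> \<phi>] by (simp add: close_def)
  then have ax: "prv S \<Delta>' \<Gamma> (close \<Delta> \<phi>)"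
    using assms(1) by (intro prv.ax)
  let ?\<theta> = "\<lambda>i. \<theta> (i + length \<Delta>)"
  have "fsub ?\<theta> (close \<Delta> \<phi>) = close \<Delta> \<phi>"
    using \<open>wff [] _\<close> by (rule fsub_ident) simp
  with ax have "prv S \<Delta>' \<Gamma> (fsub ?\<theta> (close \<Delta> \<phi>))"
    by simp
  from prv_close_instance[OF this assms(3) HOL.refl] show ?thesis .
qed

lemma Eq_sym: "prv S \<Delta> \<Gamma> (Eq \<tau> s t) \<Longrightarrow> prv S \<Delta> \<Gamma> (Eq \<tau> t s)"
  using prv.subst[of \<tau> \<Delta> "Eq \<tau> (Var 0) (ren Suc s)" S \<Gamma> s t] prv_wff[of S \<Delta> \<Gamma> "Eq \<tau> s t"]
  by (simp add: has_ty_iff_infer prv.refl)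

lemma Eq_trans:
  "prv S \<Delta> \<Gamma> (Eq \<tau> s t) \<Longrightarrow> prv S \<Delta> \<Gamma> (Eq \<tau> t u) \<Longrightarrow> prv S \<Delta> \<Gamma> (Eq \<tau> s u)"
  using prv.subst[of \<tau> \<Delta> "Eq \<tau> (ren Suc s) (Var 0)" S \<Gamma> t u] prv_wff[of S \<Delta> \<Gamma> "Eq \<tau> s t"]
  by (simp add: has_ty_iff_infer)

lemma Eq_App:
  assumes "prv S \<Delta> \<Gamma> (Eq (\<sigma> \<rightarrow> \<tau>) s s')" "prv S \<Delta> \<Gamma> (Eq \<sigma> t t')"
  shows "prv S \<Delta> \<Gamma> (Eq \<tau> (s \<cdot> t) (s' \<cdot> t'))"
proof -
  have ty: "has_ty \<Delta> s (\<sigma> \<rightarrow> \<tau>)" "has_ty \<Delta> s' (\<sigma> \<rightarrow> \<tau>)" "has_ty \<Delta> t \<sigma>" "has_ty \<Delta> t' \<sigma>"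
    using assms[THEN prv_wff] by simp_all
  have "prv S \<Delta> \<Gamma> (Eq \<tau> (s \<cdot> t) (s' \<cdot> t))"
    using prv.subst[OF _ assms(1), of "Eq \<tau> (ren Suc (s \<cdot> t)) (Var 0 \<cdot> ren Suc t)"] ty
    by (simp add: has_ty_iff_infer prv.refl)
  moreover have "prv S \<Delta> \<Gamma> (Eq \<tau> (s' \<cdot> t) (s' \<cdot> t'))"
    using prv.subst[OF _ assms(2), of "Eq \<tau> (ren Suc (s' \<cdot> t)) (ren Suc s' \<cdot> Var 0)"] ty
    by (simp add: has_ty_iff_infer prv.refl)
  ultimately show ?thesis by (rule Eq_trans)
qed

text \<open>
  \<open>cls \<Delta> \<Gamma> t\<close> is the class of the terms provably equal to \<open>t\<close>; all ill-typed terms form one class. This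
  makes \<open>cls\<close> compositional without typing side conditions, so equations between classes can be
  used for rewriting.
\<close>

definition cls :: "ty list \<Rightarrow> fm set \<Rightarrow> trm \<Rightarrow> trm set" where
  "cls \<Delta> \<Gamma> t = {u. \<forall>\<tau>. has_ty \<Delta> t \<tau> \<or> has_ty \<Delta> u \<tau> \<longrightarrow> prv HA_omega \<Delta> \<Gamma> (Eq \<tau> t u)}"

definition capp :: "ty list \<Rightarrow> fm set \<Rightarrow> trm set \<Rightarrow> trm set \<Rightarrow> trm set" where
  "capp \<Delta> \<Gamma> A B = (\<Union>s\<in>A. \<Union>t\<in>B. cls \<Delta> \<Gamma> (s \<cdot> t))"

lemma cls_self [simp]: "t \<in> cls \<Delta> \<Gamma> t"
  by (simp add: cls_def prv.refl)

lemma cls_sym: "u \<in> cls \<Delta> \<Gamma> t \<Longrightarrow> t \<in> cls \<Delta> \<Gamma> u"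
  using Eq_sym[of HA_omega \<Delta> \<Gamma> _ t u] by (simp add: cls_def)

lemma cls_trans: "u \<in> cls \<Delta> \<Gamma> t \<Longrightarrow> v \<in> cls \<Delta> \<Gamma> u \<Longrightarrow> v \<in> cls \<Delta> \<Gamma> t"
  using Eq_trans[of HA_omega \<Delta> \<Gamma> _ t u v] prv_wff[of HA_omega \<Delta> \<Gamma> "Eq _ t u"]
    prv_wff[of HA_omega \<Delta> \<Gamma> "Eq _ u v"]
  unfolding cls_def mem_Collect_eq wff.simps by blast

lemma cls_eq_iff: "cls \<Delta> \<Gamma> t = cls \<Delta> \<Gamma> u \<longleftrightarrow> u \<in> cls \<Delta> \<Gamma> t"
proof
  show "u \<in> cls \<Delta> \<Gamma> t" if "cls \<Delta> \<Gamma> t = cls \<Delta> \<Gamma> u"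
    using cls_self[of u] that by simp
  show "cls \<Delta> \<Gamma> t = cls \<Delta> \<Gamma> u" if "u \<in> cls \<Delta> \<Gamma> t"
    using that cls_sym cls_trans by (intro set_eqI iffI) meson+
qed

lemma cls_eqI: "prv HA_omega \<Delta> \<Gamma> (Eq \<tau> t u) \<Longrightarrow> cls \<Delta> \<Gamma> t = cls \<Delta> \<Gamma> u"
  using prv_wff[of HA_omega \<Delta> \<Gamma> "Eq \<tau> t u"]
  unfolding cls_eq_iff by (auto simp: cls_def has_ty_iff_infer)

lemma cls_eqD: "cls \<Delta> \<Gamma> t = cls \<Delta> \<Gamma> u \<Longrightarrow> has_ty \<Delta> t \<tau> \<Longrightarrow> prv HA_omega \<Delta> \<Gamma> (Eq \<tau> t u)"
  unfolding cls_eq_iff by (simp add: cls_def)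

lemma cls_App_cong:
  assumes "s' \<in> cls \<Delta> \<Gamma> s" "t' \<in> cls \<Delta> \<Gamma> t"
  shows "s' \<cdot> t' \<in> cls \<Delta> \<Gamma> (s \<cdot> t)"
  unfolding cls_def
proof (intro CollectI HOL.allI HOL.impI)
  fix \<tau> assume "has_ty \<Delta> (s \<cdot> t) \<tau> \<or> has_ty \<Delta> (s' \<cdot> t') \<tau>"
  then obtain \<sigma> where "has_ty \<Delta> s (\<sigma> \<rightarrow> \<tau>) \<and> has_ty \<Delta> t \<sigma> \<or> has_ty \<Delta> s' (\<sigma> \<rightarrow> \<tau>) \<and> has_ty \<Delta> t' \<sigma>"
    unfolding has_ty_App_iff by blast
  then have "prv HA_omega \<Delta> \<Gamma> (Eq (\<sigma> \<rightarrow> \<tau>) s s')" "prv HA_omega \<Delta> \<Gamma> (Eq \<sigma> t t')"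
    using assms unfolding cls_def mem_Collect_eq by blast+
  then show "prv HA_omega \<Delta> \<Gamma> (Eq \<tau> (s \<cdot> t) (s' \<cdot> t'))"
    by (rule Eq_App)
qed

lemma cls_App: "cls \<Delta> \<Gamma> (s \<cdot> t) = capp \<Delta> \<Gamma> (cls \<Delta> \<Gamma> s) (cls \<Delta> \<Gamma> t)"
proof -
  have "cls \<Delta> \<Gamma> (s' \<cdot> t') = cls \<Delta> \<Gamma> (s \<cdot> t)" if "s' \<in> cls \<Delta> \<Gamma> s" "t' \<in> cls \<Delta> \<Gamma> t" for s' t'
    using cls_sym[OF cls_App_cong[OF that]] by (simp only: cls_eq_iff)
  then have "capp \<Delta> \<Gamma> (cls \<Delta> \<Gamma> s) (cls \<Delta> \<Gamma> t) = (\<Union>s'\<in>cls \<Delta> \<Gamma> s. \<Union>t'\<in>cls \<Delta> \<Gamma> t. cls \<Delta> \<Gamma> (s \<cdot> t))"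
    unfolding capp_def by (intro SUP_cong HOL.refl)
  moreover have "cls \<Delta> \<Gamma> s \<noteq> {}" "cls \<Delta> \<Gamma> t \<noteq> {}"
    using cls_self by blast+
  ultimately show ?thesis by simp
qed

lemma cls_App_eq:
  "cls \<Delta> \<Gamma> s = cls \<Delta> \<Gamma> s' \<Longrightarrow> cls \<Delta> \<Gamma> t = cls \<Delta> \<Gamma> t' \<Longrightarrow> cls \<Delta> \<Gamma> (s \<cdot> t) = cls \<Delta> \<Gamma> (s' \<cdot> t')"
  by (simp only: cls_App)

lemma cls_beta:
  "has_ty (\<sigma> # \<Delta>) t \<tau> \<Longrightarrow> has_ty \<Delta> s \<sigma> \<Longrightarrow> cls \<Delta> \<Gamma> (Lam \<sigma> t \<cdot> s) = cls \<Delta> \<Gamma> (sub (inst s) t)"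
  by (intro cls_eqI prv.beta)

lemma sub_inst_up: "sub (inst a) (sub (up \<theta>) t) = sub (case_nat a \<theta>) t"
proof -
  have "(\<lambda>i. sub (inst a) (up \<theta> i)) = case_nat a \<theta>"
    by (rule HOL.ext) (simp add: up_def split: nat.split)
  then show ?thesis by (simp add: sub_sub)
qed

lemma cls_foldl_App: "cls \<Delta> \<Gamma> s = cls \<Delta> \<Gamma> t \<Longrightarrow> cls \<Delta> \<Gamma> (foldl App s us) = cls \<Delta> \<Gamma> (foldl App t us)"
  by (induction us arbitrary: s t) (simp_all add: cls_App)

lemma has_ty_foldr_Lam: "has_ty (rev \<sigma>s @ \<Delta>) t \<tau> \<Longrightarrow> has_ty \<Delta> (foldr Lam \<sigma>s t) (foldr FunT \<sigma>s \<tau>)"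
  by (induction \<sigma>s arbitrary: \<Delta>) (auto intro: has_ty.Lam)

lemma cls_beta_list:
  assumes "list_all2 (has_ty \<Delta>) as \<sigma>s" "has_ty (rev \<sigma>s @ \<Delta>') t \<tau>" "typed_sub \<Delta> \<theta> \<Delta>'"
  shows "cls \<Delta> \<Gamma> (foldl App (sub \<theta> (foldr Lam \<sigma>s t)) as) = cls \<Delta> \<Gamma> (sub (fold case_nat as \<theta>) t)"
  using assms
proof (induction arbitrary: \<theta> \<Delta>' rule: list_all2_induct)
  case Nil
  then show ?case by simp
next
  case (Cons a as \<sigma> \<sigma>s)
  have "has_ty (\<sigma> # \<Delta>) (sub (up \<theta>) (foldr Lam \<sigma>s t)) (foldr FunT \<sigma>s \<tau>)"
    using Cons.prems by (intro has_ty_sub[OF has_ty_foldr_Lam typed_sub_up]) auto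
  from cls_beta[OF this Cons.hyps(1), of \<Gamma>]
  have "cls \<Delta> \<Gamma> (sub \<theta> (foldr Lam (\<sigma> # \<sigma>s) t) \<cdot> a) = cls \<Delta> \<Gamma> (sub (case_nat a \<theta>) (foldr Lam \<sigma>s t))"
    by (simp add: sub_inst_up)
  from cls_foldl_App[OF this, of as]
  have "cls \<Delta> \<Gamma> (foldl App (sub \<theta> (foldr Lam (\<sigma> # \<sigma>s) t)) (a # as))
      = cls \<Delta> \<Gamma> (foldl App (sub (case_nat a \<theta>) (foldr Lam \<sigma>s t)) as)"
    by simp
  also have "\<dots> = cls \<Delta> \<Gamma> (sub (fold case_nat as (case_nat a \<theta>)) t)"
    using Cons.prems Cons.hyps(1) by (intro Cons.IH[of "\<sigma> # \<Delta>'"]) simp_all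
  finally show ?case by simp
qed

lemma cls_ext:
  assumes "has_ty \<Delta> f (\<sigma> \<rightarrow> \<tau>)" "has_ty \<Delta> g (\<sigma> \<rightarrow> \<tau>)"
    "cls (\<sigma> # \<Delta>) (lift ` \<Gamma>) (ren Suc f \<cdot> Var 0) = cls (\<sigma> # \<Delta>) (lift ` \<Gamma>) (ren Suc g \<cdot> Var 0)"
  shows "cls \<Delta> \<Gamma> f = cls \<Delta> \<Gamma> g"
proof -
  have "prv HA_omega (\<sigma> # \<Delta>) (lift ` \<Gamma>) (Eq \<tau> (ren Suc f \<cdot> Var 0) (ren Suc g \<cdot> Var 0))"
    using assms by (intro cls_eqD) (simp_all add: has_ty_iff_infer)
  then have "prv HA_omega \<Delta> \<Gamma> (Forall \<sigma> (Eq \<tau> (ren Suc f \<cdot> Var 0) (ren Suc g \<cdot> Var 0)))"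
    by (rule prv.allI)
  moreover have "prv HA_omega \<Delta> \<Gamma> (Imp (Forall \<sigma> (Eq \<tau> (ren Suc f \<cdot> Var 0) (ren Suc g \<cdot> Var 0)))
      (Eq (\<sigma> \<rightarrow> \<tau>) f g))"
    using ax_instance[of "[\<sigma> \<rightarrow> \<tau>, \<sigma> \<rightarrow> \<tau>]"
        "Imp (Forall \<sigma> (Eq \<tau> (Var 2 \<cdot> Var 0) (Var 1 \<cdot> Var 0))) (Eq (\<sigma> \<rightarrow> \<tau>) (Var 1) (Var 0))"
        HA_omega \<Delta> "case_nat g (case_nat f Var)" \<Gamma>]
      HA_omega.ext[of \<sigma> \<tau>] assms
    by (simp add: close_def has_ty_iff_infer)
  ultimately show ?thesis
    by (intro cls_eqI[of _ _ "\<sigma> \<rightarrow> \<tau>"]) (rule prv.impE)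
qed

lemma cls_axiom:
  assumes "close \<Delta> (Eq \<tau> s t) \<in> HA_omega" "wff \<Delta> (Eq \<tau> s t)" "typed_sub \<Delta>' \<theta> \<Delta>"
  shows "cls \<Delta>' \<Gamma> (sub \<theta> s) = cls \<Delta>' \<Gamma> (sub \<theta> t)"
  by (rule cls_eqI[of _ _ \<tau>]) (use ax_instance[OF assms] in simp)

lemma cond_true_eq:
  assumes "has_ty \<Delta> u \<tau>" "has_ty \<Delta> v \<tau>"
  shows "cls \<Delta> \<Gamma> (Con (Cond \<tau>) \<cdot> Con TrueC \<cdot> u \<cdot> v) = cls \<Delta> \<Gamma> u"
  using cls_axiom[of "[\<tau>, \<tau>]" \<tau> "Con (Cond \<tau>) \<cdot> Con TrueC \<cdot> Var 1 \<cdot> Var 0" "Var 1"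
      \<Delta> "case_nat v (case_nat u Var)" \<Gamma>] HA_omega.cond_true[of \<tau>] assms
  by (simp add: close_def has_ty_iff_infer)

lemma cond_false_eq:
  assumes "has_ty \<Delta> u \<tau>" "has_ty \<Delta> v \<tau>"
  shows "cls \<Delta> \<Gamma> (Con (Cond \<tau>) \<cdot> Con FalseC \<cdot> u \<cdot> v) = cls \<Delta> \<Gamma> v"
  using cls_axiom[of "[\<tau>, \<tau>]" \<tau> "Con (Cond \<tau>) \<cdot> Con FalseC \<cdot> Var 1 \<cdot> Var 0" "Var 0"
      \<Delta> "case_nat v (case_nat u Var)" \<Gamma>] HA_omega.cond_false[of \<tau>] assms
  by (simp add: close_def has_ty_iff_infer)

lemma nat_rec_zero_eq:
  assumes "has_ty \<Delta> a \<tau>" "has_ty \<Delta> f (NatT \<rightarrow> \<tau> \<rightarrow> \<tau>)"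
  shows "cls \<Delta> \<Gamma> (Con (NatRec \<tau>) \<cdot> a \<cdot> f \<cdot> Con ZeroC) = cls \<Delta> \<Gamma> a"
  using cls_axiom[of "[NatT \<rightarrow> \<tau> \<rightarrow> \<tau>, \<tau>]" \<tau> "Con (NatRec \<tau>) \<cdot> Var 1 \<cdot> Var 0 \<cdot> Con ZeroC" "Var 1"
      \<Delta> "case_nat f (case_nat a Var)" \<Gamma>] HA_omega.nat_rec_zero[of \<tau>] assms
  by (simp add: close_def has_ty_iff_infer)

lemma nat_rec_succ_eq:
  assumes "has_ty \<Delta> a \<tau>" "has_ty \<Delta> f (NatT \<rightarrow> \<tau> \<rightarrow> \<tau>)" "has_ty \<Delta> n NatT"
  shows "cls \<Delta> \<Gamma> (Con (NatRec \<tau>) \<cdot> a \<cdot> f \<cdot> (Con SuccC \<cdot> n))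
    = cls \<Delta> \<Gamma> (f \<cdot> n \<cdot> (Con (NatRec \<tau>) \<cdot> a \<cdot> f \<cdot> n))"
  using cls_axiom[of "[NatT, NatT \<rightarrow> \<tau> \<rightarrow> \<tau>, \<tau>]" \<tau>
      "Con (NatRec \<tau>) \<cdot> Var 2 \<cdot> Var 1 \<cdot> (Con SuccC \<cdot> Var 0)"
      "Var 1 \<cdot> Var 0 \<cdot> (Con (NatRec \<tau>) \<cdot> Var 2 \<cdot> Var 1 \<cdot> Var 0)"
      \<Delta> "case_nat n (case_nat f (case_nat a Var))" \<Gamma>] HA_omega.nat_rec_succ[of \<tau>] assms
  by (simp add: close_def has_ty_iff_infer)

lemma seq_rec_snoc_eq:
  assumes "has_ty \<Delta> a \<tau>" "has_ty \<Delta> f (SeqT \<sigma> \<rightarrow> \<sigma> \<rightarrow> \<tau> \<rightarrow> \<tau>)" "has_ty \<Delta> s (SeqT \<sigma>)" "has_ty \<Delta> x \<sigma>"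
  shows "cls \<Delta> \<Gamma> (Con (SeqRec \<sigma> \<tau>) \<cdot> a \<cdot> f \<cdot> (Con (SnocC \<sigma>) \<cdot> s \<cdot> x))
    = cls \<Delta> \<Gamma> (f \<cdot> s \<cdot> x \<cdot> (Con (SeqRec \<sigma> \<tau>) \<cdot> a \<cdot> f \<cdot> s))"
  using cls_axiom[of "[\<sigma>, SeqT \<sigma>, SeqT \<sigma> \<rightarrow> \<sigma> \<rightarrow> \<tau> \<rightarrow> \<tau>, \<tau>]" \<tau>
      "Con (SeqRec \<sigma> \<tau>) \<cdot> Var 3 \<cdot> Var 2 \<cdot> (Con (SnocC \<sigma>) \<cdot> Var 1 \<cdot> Var 0)"
      "Var 2 \<cdot> Var 1 \<cdot> Var 0 \<cdot> (Con (SeqRec \<sigma> \<tau>) \<cdot> Var 3 \<cdot> Var 2 \<cdot> Var 1)"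
      \<Delta> "case_nat x (case_nat s (case_nat f (case_nat a Var)))" \<Gamma>]
    HA_omega.seq_rec_snoc[of \<tau> \<sigma>] assms
  by (simp add: close_def has_ty_iff_infer)

lemma nat_induct_eq:
  assumes "has_ty (NatT # \<Delta>) a \<tau>" "has_ty (NatT # \<Delta>) b \<tau>" "has_ty \<Delta> n NatT"
    and zero: "cls \<Delta> \<Gamma> (sub (inst (Con ZeroC)) a) = cls \<Delta> \<Gamma> (sub (inst (Con ZeroC)) b)"
    and succ: "\<And>\<Gamma>' \<theta>. \<lbrakk>\<Gamma>' = insert (Eq \<tau> a b) (lift ` \<Gamma>); \<theta> = case_nat (Con SuccC \<cdot> Var 0) (\<lambda>i. Var (Suc i));
      cls (NatT # \<Delta>) \<Gamma>' a = cls (NatT # \<Delta>) \<Gamma>' b\<rbrakk> \<Longrightarrow>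
      cls (NatT # \<Delta>) \<Gamma>' (sub \<theta> a) = cls (NatT # \<Delta>) \<Gamma>' (sub \<theta> b)"
  shows "cls \<Delta> \<Gamma> (sub (inst n) a) = cls \<Delta> \<Gamma> (sub (inst n) b)"
proof -
  let ?\<theta> = "case_nat (Con SuccC \<cdot> Var 0) (\<lambda>i. Var (Suc i))"
  let ?\<Gamma> = "insert (Eq \<tau> a b) (lift ` \<Gamma>)"
  have wff: "wff (NatT # \<Delta>) (Eq \<tau> a b)"
    using assms by simp
  have \<theta>: "typed_sub (NatT # \<Delta>) ?\<theta> (NatT # \<Delta>)"
    by (simp add: has_ty_iff_infer) (simp add: typed_sub_def has_ty_iff_infer)
  have "prv HA_omega \<Delta> \<Gamma> (Imp (fsub (inst (Con ZeroC)) (Eq \<tau> a b))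
      (Imp (Forall NatT (Imp (Eq \<tau> a b) (fsub ?\<theta> (Eq \<tau> a b)))) (Forall NatT (Eq \<tau> a b))))"
  proof (rule ax_instance[OF HA_omega.nat_ind[OF wff] _ typed_sub_Var, unfolded fsub_Var])
    show "wff \<Delta> (Imp (fsub (inst (Con ZeroC)) (Eq \<tau> a b))
        (Imp (Forall NatT (Imp (Eq \<tau> a b) (fsub ?\<theta> (Eq \<tau> a b)))) (Forall NatT (Eq \<tau> a b))))"
      using wff wff_fsub[OF wff \<theta>] wff_fsub[OF wff typed_sub_inst[of \<Delta> "Con ZeroC"]]
      by (simp add: has_ty_iff_infer)
  qed
  moreover have "prv HA_omega \<Delta> \<Gamma> (fsub (inst (Con ZeroC)) (Eq \<tau> a b))"
    using cls_eqD[OF zero] has_ty_sub[OF assms(1) typed_sub_inst[of \<Delta> "Con ZeroC"]]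
    by (simp add: has_ty_iff_infer)
  moreover have "prv HA_omega \<Delta> \<Gamma> (Forall NatT (Imp (Eq \<tau> a b) (fsub ?\<theta> (Eq \<tau> a b))))"
  proof (intro prv.allI prv.impI wff)
    have "cls (NatT # \<Delta>) ?\<Gamma> a = cls (NatT # \<Delta>) ?\<Gamma> b"
      using wff by (intro cls_eqI[of _ _ \<tau>] prv.asm) simp_all
    then show "prv HA_omega (NatT # \<Delta>) ?\<Gamma> (fsub ?\<theta> (Eq \<tau> a b))"
      using cls_eqD[OF succ has_ty_sub[OF assms(1) \<theta>]] by simp
  qed
  ultimately have "prv HA_omega \<Delta> \<Gamma> (Forall NatT (Eq \<tau> a b))"
    by (meson prv.impE)
  from prv.allE[OF this assms(3)] show ?thesis
    by (intro cls_eqI[of _ _ \<tau>]) simp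
qed

lemma bool_cases_eq:
  assumes "has_ty (BoolT # \<Delta>) a \<tau>" "has_ty (BoolT # \<Delta>) b \<tau>" "has_ty \<Delta> c BoolT"
    and true: "cls \<Delta> \<Gamma> (sub (inst (Con TrueC)) a) = cls \<Delta> \<Gamma> (sub (inst (Con TrueC)) b)"
    and false: "cls \<Delta> \<Gamma> (sub (inst (Con FalseC)) a) = cls \<Delta> \<Gamma> (sub (inst (Con FalseC)) b)"
  shows "cls \<Delta> \<Gamma> (sub (inst c) a) = cls \<Delta> \<Gamma> (sub (inst c) b)"
proof -
  have wff: "wff (BoolT # \<Delta>) (Eq \<tau> a b)"
    using assms by simp
  have "prv HA_omega \<Delta> \<Gamma> (Imp (fsub (inst (Con TrueC)) (Eq \<tau> a b))
      (Imp (fsub (inst (Con FalseC)) (Eq \<tau> a b)) (Forall BoolT (Eq \<tau> a b))))"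
  proof (rule ax_instance[OF HA_omega.bool_ind[OF wff] _ typed_sub_Var, unfolded fsub_Var])
    show "wff \<Delta> (Imp (fsub (inst (Con TrueC)) (Eq \<tau> a b))
        (Imp (fsub (inst (Con FalseC)) (Eq \<tau> a b)) (Forall BoolT (Eq \<tau> a b))))"
      using wff wff_fsub[OF wff typed_sub_inst[of \<Delta> "Con TrueC"]]
        wff_fsub[OF wff typed_sub_inst[of \<Delta> "Con FalseC"]]
      by (simp add: has_ty_iff_infer)
  qed
  moreover have "prv HA_omega \<Delta> \<Gamma> (fsub (inst (Con TrueC)) (Eq \<tau> a b))"
    using cls_eqD[OF true] has_ty_sub[OF assms(1) typed_sub_inst[of \<Delta> "Con TrueC"]]
    by (simp add: has_ty_iff_infer)
  moreover have "prv HA_omega \<Delta> \<Gamma> (fsub (inst (Con FalseC)) (Eq \<tau> a b))"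
    using cls_eqD[OF false] has_ty_sub[OF assms(1) typed_sub_inst[of \<Delta> "Con FalseC"]]
    by (simp add: has_ty_iff_infer)
  ultimately have "prv HA_omega \<Delta> \<Gamma> (Forall BoolT (Eq \<tau> a b))"
    by (meson prv.impE)
  from prv.allE[OF this assms(3)] show ?thesis
    by (intro cls_eqI[of _ _ \<tau>]) simp
qed

lemma cond_App:
  assumes "has_ty \<Delta> g (\<sigma> \<rightarrow> \<tau>)" "has_ty \<Delta> c BoolT" "has_ty \<Delta> u \<sigma>" "has_ty \<Delta> v \<sigma>"
  shows "cls \<Delta> \<Gamma> (g \<cdot> (Con (Cond \<sigma>) \<cdot> c \<cdot> u \<cdot> v)) = cls \<Delta> \<Gamma> (Con (Cond \<tau>) \<cdot> c \<cdot> (g \<cdot> u) \<cdot> (g \<cdot> v))"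
  using bool_cases_eq[of \<Delta> "ren Suc g \<cdot> (Con (Cond \<sigma>) \<cdot> Var 0 \<cdot> ren Suc u \<cdot> ren Suc v)" \<tau>
      "Con (Cond \<tau>) \<cdot> Var 0 \<cdot> (ren Suc g \<cdot> ren Suc u) \<cdot> (ren Suc g \<cdot> ren Suc v)" c \<Gamma>]
    cond_true_eq[of \<Delta> u \<sigma> v \<Gamma>] cond_true_eq[of \<Delta> "g \<cdot> u" \<tau> "g \<cdot> v" \<Gamma>]
    cond_false_eq[of \<Delta> u \<sigma> v \<Gamma>] cond_false_eq[of \<Delta> "g \<cdot> u" \<tau> "g \<cdot> v" \<Gamma>] assms
  by (simp add: has_ty_iff_infer cls_App)

section \<open>Closed terms and their computation rules\<close>

declare has_ty_iff_infer [simp]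

lemma ren_Lam_ren_Suc [simp]: "ren (case_nat 0 (\<lambda>i. Suc (\<rho> i))) (ren Suc t) = ren Suc (ren \<rho> t)"
  by (simp add: ren_ren)

lemma infer_closed: "infer t [] = Some \<tau> \<Longrightarrow> infer t \<Delta> = Some \<tau>"
  using has_ty_sub[of "[]" t \<tau> \<Delta> Var] by simp

lemma sub_closed: "infer t [] = Some \<tau> \<Longrightarrow> sub \<theta> t = t"
  using sub_ident[of "[]" t \<tau> \<theta>] by simp

lemma ren_closed: "infer t [] = Some \<tau> \<Longrightarrow> ren \<rho> t = t"
  by (simp add: ren_eq_sub sub_closed)

lemmas closed = infer_closed sub_closed ren_closed

lemma cls_beta_closed:
  assumes "infer t (rev \<sigma>s) = Some \<tau>" "list_all2 (has_ty \<Delta>) as \<sigma>s"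
  shows "cls \<Delta> \<Gamma> (foldl App (foldr Lam \<sigma>s t) as) = cls \<Delta> \<Gamma> (sub (fold case_nat as Var) t)"
  using cls_beta_list[of \<Delta> as \<sigma>s "[]" t \<tau> Var \<Gamma>] assms by simp

lemma cls_xi:
  assumes "has_ty (\<sigma> # \<Delta>) a \<tau>" "has_ty (\<sigma> # \<Delta>) b \<tau>"
    "cls (\<sigma> # \<Delta>) (lift ` \<Gamma>) a = cls (\<sigma> # \<Delta>) (lift ` \<Gamma>) b"
  shows "cls \<Delta> \<Gamma> (Lam \<sigma> a) = cls \<Delta> \<Gamma> (Lam \<sigma> b)"
proof (rule cls_ext[of _ _ \<sigma> \<tau>])
  have eta: "cls (\<sigma> # \<Delta>) (lift ` \<Gamma>) (ren Suc (Lam \<sigma> t) \<cdot> Var 0) = cls (\<sigma> # \<Delta>) (lift ` \<Gamma>) t"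
    if "has_ty (\<sigma> # \<Delta>) t \<tau>" for t
  proof -
    let ?\<rho> = "case_nat 0 (\<lambda>i. Suc (Suc i))"
    have "(\<lambda>i. inst (Var 0) (?\<rho> i)) = Var"
      by (rule HOL.ext) (simp split: nat.split)
    moreover have "has_ty (\<sigma> # \<sigma> # \<Delta>) (ren ?\<rho> t) \<tau>"
      using that by (rule has_ty_ren) (auto split: nat.split)
    ultimately show ?thesis
      using cls_beta[of \<sigma> "\<sigma> # \<Delta>" "ren ?\<rho> t" \<tau> "Var 0" "lift ` \<Gamma>"] by (simp add: sub_ren)
  qed
  show "cls (\<sigma> # \<Delta>) (lift ` \<Gamma>) (ren Suc (Lam \<sigma> a) \<cdot> Var 0)
      = cls (\<sigma> # \<Delta>) (lift ` \<Gamma>) (ren Suc (Lam \<sigma> b) \<cdot> Var 0)"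
    using eta[OF assms(1)] eta[OF assms(2)] assms(3) by simp
qed (use assms in simp_all)

abbreviation strategy :: "ty \<Rightarrow> ty" where
  "strategy X \<equiv> SeqT X \<rightarrow> X"

text \<open>
  \<open>history X \<cdot> \<alpha> \<cdot> s \<cdot> n\<close> is the position reached after \<open>n\<close> moves from \<open>s\<close>. In the notation of the
  introduction, \<open>play X \<cdot> s \<cdot> \<alpha>\<close> is \<open>\<alpha>\<^sup>s\<close>, \<open>select_strategy X R \<cdot> \<epsilon>\<close> is \<open>\<epsilon>'\<close> and \<open>outcome X R \<cdot> q \<cdot> s\<close> is \<open>q\<^sup>s\<close>.
\<close>

definition history :: "ty \<Rightarrow> trm" where
  "history X = Lam (NatT \<rightarrow> strategy X) (Lam (SeqT X) (Lam NatT
    (Con (NatRec (SeqT X)) \<cdot> Var 1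
      \<cdot> Lam NatT (Lam (SeqT X) (Con (SnocC X) \<cdot> Var 0 \<cdot> (Var 4 \<cdot> Var 1 \<cdot> Var 0))) \<cdot> Var 0)))"

definition play :: "ty \<Rightarrow> trm" where
  "play X = Lam (SeqT X) (Lam (NatT \<rightarrow> strategy X) (Lam NatT
    (Var 1 \<cdot> Var 0 \<cdot> (history X \<cdot> Var 1 \<cdot> Var 2 \<cdot> Var 0))))"

definition constant_strategy :: "ty \<Rightarrow> trm" where
  "constant_strategy X = Lam X (Lam (SeqT X) (Var 1))"

definition select_strategy :: "ty \<Rightarrow> ty \<Rightarrow> trm" where
  "select_strategy X R = Lam (SeqT X \<rightarrow> J R X) (Lam NatT (Lam (strategy X \<rightarrow> R) (Lam (SeqT X)
    (Var 3 \<cdot> Var 0 \<cdot> Lam X (Var 2 \<cdot> (constant_strategy X \<cdot> Var 0))))))"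

definition outcome :: "ty \<Rightarrow> ty \<Rightarrow> trm" where
  "outcome X R = Lam ((NatT \<rightarrow> X) \<rightarrow> R) (Lam (SeqT X) (Lam (NatT \<rightarrow> strategy X)
    (Var 2 \<cdot> (play X \<cdot> Var 1 \<cdot> Var 0))))"

definition EPS_of_eps :: "ty \<Rightarrow> ty \<Rightarrow> trm" where
  "EPS_of_eps X R = Lam (eps_ty (strategy X) R) (Lam (R \<rightarrow> NatT) (Lam (SeqT X)
    (Lam (SeqT X \<rightarrow> J R X) (Lam ((NatT \<rightarrow> X) \<rightarrow> R)
      (play X \<cdot> Var 2 \<cdot> (Var 4 \<cdot> Var 3 \<cdot> (len X \<cdot> Var 2) \<cdot> (select_strategy X R \<cdot> Var 1)
        \<cdot> (outcome X R \<cdot> Var 0 \<cdot> Var 2)))))))"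

lemma infer_zero: "infer (zero X) \<Delta> = Some X"
  by (induction X arbitrary: \<Delta>) simp_all

lemma infer_lessb: "infer lessb [] = Some (NatT \<rightarrow> NatT \<rightarrow> BoolT)"
  by (simp add: lessb_def positive_def monus_def predec_def)

lemma infer_len: "infer (len X) [] = Some (SeqT X \<rightarrow> NatT)"
  by (simp add: len_def)

lemma infer_cons: "infer (cons X) [] = Some (X \<rightarrow> (NatT \<rightarrow> X) \<rightarrow> NatT \<rightarrow> X)"
  by (simp add: cons_def)

lemmas closed_cons [simp] = closed[OF infer_cons]
lemmas closed_len [simp] = closed[OF infer_len]
lemmas closed_lessb [simp] = closed[OF infer_lessb]
lemmas closed_zero [simp] = closed[OF infer_zero]

lemma infer_after: "infer (after X R) [] = Some (((NatT \<rightarrow> X) \<rightarrow> R) \<rightarrow> X \<rightarrow> (NatT \<rightarrow> X) \<rightarrow> R)"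
  by (simp add: after_def)

lemmas closed_after [simp] = closed[OF infer_after]

lemma infer_history: "infer (history X) [] = Some ((NatT \<rightarrow> strategy X) \<rightarrow> SeqT X \<rightarrow> NatT \<rightarrow> SeqT X)"
  by (simp add: history_def)

lemmas closed_history [simp] = closed[OF infer_history]

lemma infer_play: "infer (play X) [] = Some (SeqT X \<rightarrow> (NatT \<rightarrow> strategy X) \<rightarrow> NatT \<rightarrow> X)"
  by (simp add: play_def)

lemmas closed_play [simp] = closed[OF infer_play]

lemma infer_constant_strategy: "infer (constant_strategy X) [] = Some (X \<rightarrow> strategy X)"
  by (simp add: constant_strategy_def)

lemmas closed_constant_strategy [simp] = closed[OF infer_constant_strategy]

lemma infer_select_strategy:
  "infer (select_strategy X R) [] = Some ((SeqT X \<rightarrow> J R X) \<rightarrow> NatT \<rightarrow> J R (strategy X))"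
  by (simp add: select_strategy_def J_def)

lemmas closed_select_strategy [simp] = closed[OF infer_select_strategy]

lemma infer_outcome:
  "infer (outcome X R) [] = Some (((NatT \<rightarrow> X) \<rightarrow> R) \<rightarrow> SeqT X \<rightarrow> (NatT \<rightarrow> strategy X) \<rightarrow> R)"
  by (simp add: outcome_def)

lemmas closed_outcome [simp] = closed[OF infer_outcome]

lemma infer_EPS_of_eps: "infer (EPS_of_eps X R) [] = Some (eps_ty (strategy X) R \<rightarrow> EPS_ty X R)"
  by (simp add: EPS_of_eps_def eps_ty_def EPS_ty_def)

lemmas closed_EPS_of_eps [simp] = closed[OF infer_EPS_of_eps]

lemma cons_eq:
  assumes "has_ty \<Delta> x X" "has_ty \<Delta> \<alpha> (NatT \<rightarrow> X)" "has_ty \<Delta> n NatT"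
  shows "cls \<Delta> \<Gamma> (cons X \<cdot> x \<cdot> \<alpha> \<cdot> n)
    = cls \<Delta> \<Gamma> (Con (NatRec X) \<cdot> x \<cdot> Lam NatT (Lam X (ren Suc (ren Suc \<alpha>) \<cdot> Var 1)) \<cdot> n)"
  using cls_beta_closed[of "Con (NatRec X) \<cdot> Var 2 \<cdot> Lam NatT (Lam X (Var 3 \<cdot> Var 1)) \<cdot> Var 0"
      "[X, NatT \<rightarrow> X, NatT]" X \<Delta> "[x, \<alpha>, n]" \<Gamma>] assms
  by (simp add: cons_def)

lemma cons_zero:
  assumes "has_ty \<Delta> x X" "has_ty \<Delta> \<alpha> (NatT \<rightarrow> X)"
  shows "cls \<Delta> \<Gamma> (cons X \<cdot> x \<cdot> \<alpha> \<cdot> Con ZeroC) = cls \<Delta> \<Gamma> x"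
  using assms by (subst cons_eq) (simp_all add: nat_rec_zero_eq)

lemma cons_succ:
  assumes "has_ty \<Delta> x X" "has_ty \<Delta> \<alpha> (NatT \<rightarrow> X)" "has_ty \<Delta> n NatT"
  shows "cls \<Delta> \<Gamma> (cons X \<cdot> x \<cdot> \<alpha> \<cdot> (Con SuccC \<cdot> n)) = cls \<Delta> \<Gamma> (\<alpha> \<cdot> n)"
  using cls_beta_list[of \<Delta>
      "[n, Con (NatRec X) \<cdot> x \<cdot> Lam NatT (Lam X (ren Suc (ren Suc \<alpha>) \<cdot> Var 1)) \<cdot> n]" "[NatT, X]"
      \<Delta> "ren Suc (ren Suc \<alpha>) \<cdot> Var 1" X Var \<Gamma>] assms
  by (subst cons_eq) (simp_all add: nat_rec_succ_eq typed_sub_Var)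

lemma after_eq:
  assumes "has_ty \<Delta> q ((NatT \<rightarrow> X) \<rightarrow> R)" "has_ty \<Delta> x X" "has_ty \<Delta> \<alpha> (NatT \<rightarrow> X)"
  shows "cls \<Delta> \<Gamma> (after X R \<cdot> q \<cdot> x \<cdot> \<alpha>) = cls \<Delta> \<Gamma> (q \<cdot> (cons X \<cdot> x \<cdot> \<alpha>))"
  using cls_beta_closed[of "Var 2 \<cdot> (cons X \<cdot> Var 1 \<cdot> Var 0)"
      "[(NatT \<rightarrow> X) \<rightarrow> R, X, NatT \<rightarrow> X]" R \<Delta> "[q, x, \<alpha>]" \<Gamma>] assms
  by (simp add: after_def)

lemma len_snoc:
  assumes "has_ty \<Delta> s (SeqT X)" "has_ty \<Delta> x X"
  shows "cls \<Delta> \<Gamma> (len X \<cdot> (Con (SnocC X) \<cdot> s \<cdot> x)) = cls \<Delta> \<Gamma> (Con SuccC \<cdot> (len X \<cdot> s))"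
  using cls_beta_closed[of "Con SuccC \<cdot> Var 0" "[SeqT X, X, NatT]" NatT \<Delta> "[s, x, len X \<cdot> s]" \<Gamma>]
    seq_rec_snoc_eq[of \<Delta> "Con ZeroC" NatT "Lam (SeqT X) (Lam X (Lam NatT (Con SuccC \<cdot> Var 0)))" X s x \<Gamma>]
    assms
  by (simp add: len_def)

lemma history_eq:
  assumes "has_ty \<Delta> \<alpha> (NatT \<rightarrow> strategy X)" "has_ty \<Delta> s (SeqT X)" "has_ty \<Delta> n NatT"
  shows "cls \<Delta> \<Gamma> (history X \<cdot> \<alpha> \<cdot> s \<cdot> n)
    = cls \<Delta> \<Gamma> (Con (NatRec (SeqT X)) \<cdot> s \<cdot> Lam NatT (Lam (SeqT X)
        (Con (SnocC X) \<cdot> Var 0 \<cdot> (ren Suc (ren Suc \<alpha>) \<cdot> Var 1 \<cdot> Var 0))) \<cdot> n)"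
  using cls_beta_closed[of "Con (NatRec (SeqT X)) \<cdot> Var 1
        \<cdot> Lam NatT (Lam (SeqT X) (Con (SnocC X) \<cdot> Var 0 \<cdot> (Var 4 \<cdot> Var 1 \<cdot> Var 0))) \<cdot> Var 0"
      "[NatT \<rightarrow> strategy X, SeqT X, NatT]" "SeqT X" \<Delta> "[\<alpha>, s, n]" \<Gamma>] assms
  by (simp add: history_def)

lemma history_zero:
  assumes "has_ty \<Delta> \<alpha> (NatT \<rightarrow> strategy X)" "has_ty \<Delta> s (SeqT X)"
  shows "cls \<Delta> \<Gamma> (history X \<cdot> \<alpha> \<cdot> s \<cdot> Con ZeroC) = cls \<Delta> \<Gamma> s"
  using assms by (subst history_eq) (simp_all add: nat_rec_zero_eq)

lemma history_succ:
  assumes "has_ty \<Delta> \<alpha> (NatT \<rightarrow> strategy X)" "has_ty \<Delta> s (SeqT X)" "has_ty \<Delta> n NatT"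
  shows "cls \<Delta> \<Gamma> (history X \<cdot> \<alpha> \<cdot> s \<cdot> (Con SuccC \<cdot> n))
    = cls \<Delta> \<Gamma> (Con (SnocC X) \<cdot> (history X \<cdot> \<alpha> \<cdot> s \<cdot> n) \<cdot> (\<alpha> \<cdot> n \<cdot> (history X \<cdot> \<alpha> \<cdot> s \<cdot> n)))"
proof -
  let ?t = "Con (SnocC X) \<cdot> Var 0 \<cdot> (ren Suc (ren Suc \<alpha>) \<cdot> Var 1 \<cdot> Var 0)"
  let ?h = "Con (NatRec (SeqT X)) \<cdot> s \<cdot> Lam NatT (Lam (SeqT X) ?t) \<cdot> n"
  have "cls \<Delta> \<Gamma> (history X \<cdot> \<alpha> \<cdot> s \<cdot> (Con SuccC \<cdot> n)) = cls \<Delta> \<Gamma> (Lam NatT (Lam (SeqT X) ?t) \<cdot> n \<cdot> ?h)"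
    using assms by (subst history_eq) (simp_all add: nat_rec_succ_eq)
  also have "\<dots> = cls \<Delta> \<Gamma> (Con (SnocC X) \<cdot> ?h \<cdot> (\<alpha> \<cdot> n \<cdot> ?h))"
    using cls_beta_list[of \<Delta> "[n, ?h]" "[NatT, SeqT X]" \<Delta> ?t "SeqT X" Var \<Gamma>] assms
    by (simp add: typed_sub_Var)
  finally show ?thesis
    using history_eq[OF assms, of \<Gamma>] by (simp add: cls_App)
qed

lemma play_eq:
  assumes "has_ty \<Delta> s (SeqT X)" "has_ty \<Delta> \<alpha> (NatT \<rightarrow> strategy X)" "has_ty \<Delta> n NatT"
  shows "cls \<Delta> \<Gamma> (play X \<cdot> s \<cdot> \<alpha> \<cdot> n) = cls \<Delta> \<Gamma> (\<alpha> \<cdot> n \<cdot> (history X \<cdot> \<alpha> \<cdot> s \<cdot> n))"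
  using cls_beta_closed[of "Var 1 \<cdot> Var 0 \<cdot> (history X \<cdot> Var 1 \<cdot> Var 2 \<cdot> Var 0)"
      "[SeqT X, NatT \<rightarrow> strategy X, NatT]" X \<Delta> "[s, \<alpha>, n]" \<Gamma>] assms
  by (simp add: play_def)

lemma constant_strategy_eq:
  assumes "has_ty \<Delta> x X" "has_ty \<Delta> s (SeqT X)"
  shows "cls \<Delta> \<Gamma> (constant_strategy X \<cdot> x \<cdot> s) = cls \<Delta> \<Gamma> x"
  using cls_beta_closed[of "Var 1" "[X, SeqT X]" X \<Delta> "[x, s]" \<Gamma>] assms
  by (simp add: constant_strategy_def)

lemma select_strategy_eq:
  assumes "has_ty \<Delta> e (SeqT X \<rightarrow> J R X)" "has_ty \<Delta> n NatT" "has_ty \<Delta> p (strategy X \<rightarrow> R)"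
    "has_ty \<Delta> s (SeqT X)"
  shows "cls \<Delta> \<Gamma> (select_strategy X R \<cdot> e \<cdot> n \<cdot> p \<cdot> s)
    = cls \<Delta> \<Gamma> (e \<cdot> s \<cdot> Lam X (ren Suc p \<cdot> (constant_strategy X \<cdot> Var 0)))"
  using cls_beta_closed[of "Var 3 \<cdot> Var 0 \<cdot> Lam X (Var 2 \<cdot> (constant_strategy X \<cdot> Var 0))"
      "[SeqT X \<rightarrow> J R X, NatT, strategy X \<rightarrow> R, SeqT X]" X \<Delta> "[e, n, p, s]" \<Gamma>] assms
  by (simp add: select_strategy_def J_def)

lemma outcome_eq:
  assumes "has_ty \<Delta> q ((NatT \<rightarrow> X) \<rightarrow> R)" "has_ty \<Delta> s (SeqT X)" "has_ty \<Delta> \<alpha> (NatT \<rightarrow> strategy X)"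
  shows "cls \<Delta> \<Gamma> (outcome X R \<cdot> q \<cdot> s \<cdot> \<alpha>) = cls \<Delta> \<Gamma> (q \<cdot> (play X \<cdot> s \<cdot> \<alpha>))"
  using cls_beta_closed[of "Var 2 \<cdot> (play X \<cdot> Var 1 \<cdot> Var 0)"
      "[(NatT \<rightarrow> X) \<rightarrow> R, SeqT X, NatT \<rightarrow> strategy X]" R \<Delta> "[q, s, \<alpha>]" \<Gamma>] assms
  by (simp add: outcome_def)

lemma EPS_of_eps_eq:
  assumes "has_ty \<Delta> F (eps_ty (strategy X) R)" "has_ty \<Delta> l (R \<rightarrow> NatT)" "has_ty \<Delta> s (SeqT X)"
    "has_ty \<Delta> e (SeqT X \<rightarrow> J R X)" "has_ty \<Delta> q ((NatT \<rightarrow> X) \<rightarrow> R)"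
  shows "cls \<Delta> \<Gamma> (EPS_of_eps X R \<cdot> F \<cdot> l \<cdot> s \<cdot> e \<cdot> q)
    = cls \<Delta> \<Gamma> (play X \<cdot> s \<cdot> (F \<cdot> l \<cdot> (len X \<cdot> s) \<cdot> (select_strategy X R \<cdot> e) \<cdot> (outcome X R \<cdot> q \<cdot> s)))"
  using cls_beta_closed[of "play X \<cdot> Var 2 \<cdot> (Var 4 \<cdot> Var 3 \<cdot> (len X \<cdot> Var 2)
        \<cdot> (select_strategy X R \<cdot> Var 1) \<cdot> (outcome X R \<cdot> Var 0 \<cdot> Var 2))"
      "[eps_ty (strategy X) R, R \<rightarrow> NatT, SeqT X, SeqT X \<rightarrow> J R X, (NatT \<rightarrow> X) \<rightarrow> R]" "NatT \<rightarrow> X" \<Delta>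
      "[F, l, s, e, q]" \<Gamma>] assms
  by (simp add: EPS_of_eps_def eps_ty_def)

section \<open>Playing strategies\<close>

lemma sub_Var_Suc [simp]: "sub (\<lambda>i. Var (Suc i)) t = ren Suc t"
  by (simp add: ren_eq_sub)

lemma history_cons:
  assumes "has_ty \<Delta> y (strategy X)" "has_ty \<Delta> \<alpha> (NatT \<rightarrow> strategy X)" "has_ty \<Delta> s (SeqT X)"
    "has_ty \<Delta> n NatT"
  shows "cls \<Delta> \<Gamma> (history X \<cdot> (cons (strategy X) \<cdot> y \<cdot> \<alpha>) \<cdot> s \<cdot> (Con SuccC \<cdot> n))
    = cls \<Delta> \<Gamma> (history X \<cdot> \<alpha> \<cdot> (Con (SnocC X) \<cdot> s \<cdot> (y \<cdot> s)) \<cdot> n)"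
proof -
  let ?a = "\<lambda>y \<alpha> s n. history X \<cdot> (cons (strategy X) \<cdot> y \<cdot> \<alpha>) \<cdot> s \<cdot> (Con SuccC \<cdot> n)"
  let ?b = "\<lambda>y \<alpha> s n. history X \<cdot> \<alpha> \<cdot> (Con (SnocC X) \<cdot> s \<cdot> (y \<cdot> s)) \<cdot> n"
  have zero: "cls \<Delta> \<Gamma> (?a y \<alpha> s (Con ZeroC)) = cls \<Delta> \<Gamma> (?b y \<alpha> s (Con ZeroC))"
    using history_succ[of \<Delta> "cons (strategy X) \<cdot> y \<cdot> \<alpha>" X s "Con ZeroC" \<Gamma>]
      history_zero[of \<Delta> "cons (strategy X) \<cdot> y \<cdot> \<alpha>" X s \<Gamma>]
      history_zero[of \<Delta> \<alpha> X "Con (SnocC X) \<cdot> s \<cdot> (y \<cdot> s)" \<Gamma>]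
      cons_zero[of \<Delta> y "strategy X" \<alpha> \<Gamma>] assms
    by (simp add: cls_App)
  have succ: "cls \<Delta> \<Gamma> (?a y \<alpha> s (Con SuccC \<cdot> n)) = cls \<Delta> \<Gamma> (?b y \<alpha> s (Con SuccC \<cdot> n))"
    if "cls \<Delta> \<Gamma> (?a y \<alpha> s n) = cls \<Delta> \<Gamma> (?b y \<alpha> s n)"
      "has_ty \<Delta> y (strategy X)" "has_ty \<Delta> \<alpha> (NatT \<rightarrow> strategy X)" "has_ty \<Delta> s (SeqT X)"
      "has_ty \<Delta> n NatT" for \<Delta> \<Gamma> y \<alpha> s n
    using history_succ[of \<Delta> "cons (strategy X) \<cdot> y \<cdot> \<alpha>" X s "Con SuccC \<cdot> n" \<Gamma>]
      history_succ[of \<Delta> \<alpha> X "Con (SnocC X) \<cdot> s \<cdot> (y \<cdot> s)" n \<Gamma>]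
      cons_succ[of \<Delta> y "strategy X" \<alpha> n \<Gamma>] that
    by (simp add: cls_App)
  show ?thesis
    using nat_induct_eq[of \<Delta> "?a (ren Suc y) (ren Suc \<alpha>) (ren Suc s) (Var 0)" "SeqT X"
        "?b (ren Suc y) (ren Suc \<alpha>) (ren Suc s) (Var 0)" n \<Gamma>]
      zero succ[of "NatT # \<Delta>" _ "ren Suc y" "ren Suc \<alpha>" "ren Suc s" "Var 0"] assms
    by simp
qed

lemma play_cons:
  assumes "has_ty \<Delta> y (strategy X)" "has_ty \<Delta> \<alpha> (NatT \<rightarrow> strategy X)" "has_ty \<Delta> s (SeqT X)"
  shows "cls \<Delta> \<Gamma> (play X \<cdot> s \<cdot> (cons (strategy X) \<cdot> y \<cdot> \<alpha>))
    = cls \<Delta> \<Gamma> (cons X \<cdot> (y \<cdot> s) \<cdot> (play X \<cdot> (Con (SnocC X) \<cdot> s \<cdot> (y \<cdot> s)) \<cdot> \<alpha>))"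
proof -
  let ?a = "\<lambda>y \<alpha> s n. play X \<cdot> s \<cdot> (cons (strategy X) \<cdot> y \<cdot> \<alpha>) \<cdot> n"
  let ?b = "\<lambda>y \<alpha> s n. cons X \<cdot> (y \<cdot> s) \<cdot> (play X \<cdot> (Con (SnocC X) \<cdot> s \<cdot> (y \<cdot> s)) \<cdot> \<alpha>) \<cdot> n"
  have zero: "cls \<Delta> \<Gamma> (?a y \<alpha> s (Con ZeroC)) = cls \<Delta> \<Gamma> (?b y \<alpha> s (Con ZeroC))"
    if "has_ty \<Delta> y (strategy X)" "has_ty \<Delta> \<alpha> (NatT \<rightarrow> strategy X)" "has_ty \<Delta> s (SeqT X)" for \<Delta> \<Gamma> y \<alpha> s
  proof -
    have "cls \<Delta> \<Gamma> (?a y \<alpha> s (Con ZeroC)) = cls \<Delta> \<Gamma> (cons (strategy X) \<cdot> y \<cdot> \<alpha> \<cdot> Con ZeroC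
        \<cdot> (history X \<cdot> (cons (strategy X) \<cdot> y \<cdot> \<alpha>) \<cdot> s \<cdot> Con ZeroC))"
      using that by (intro play_eq) simp_all
    also have "\<dots> = cls \<Delta> \<Gamma> (y \<cdot> s)"
      using history_zero[of \<Delta> "cons (strategy X) \<cdot> y \<cdot> \<alpha>" X s \<Gamma>]
        cons_zero[of \<Delta> y "strategy X" \<alpha> \<Gamma>] that
      by (simp add: cls_App)
    also have "\<dots> = cls \<Delta> \<Gamma> (?b y \<alpha> s (Con ZeroC))"
      using that by (intro cons_zero[symmetric]) simp_all
    finally show ?thesis .
  qed
  have succ: "cls \<Delta> \<Gamma> (?a y \<alpha> s (Con SuccC \<cdot> n)) = cls \<Delta> \<Gamma> (?b y \<alpha> s (Con SuccC \<cdot> n))"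
    if "has_ty \<Delta> y (strategy X)" "has_ty \<Delta> \<alpha> (NatT \<rightarrow> strategy X)" "has_ty \<Delta> s (SeqT X)"
      "has_ty \<Delta> n NatT" for \<Delta> \<Gamma> y \<alpha> s n
  proof -
    have "cls \<Delta> \<Gamma> (?a y \<alpha> s (Con SuccC \<cdot> n)) = cls \<Delta> \<Gamma> (cons (strategy X) \<cdot> y \<cdot> \<alpha> \<cdot> (Con SuccC \<cdot> n)
        \<cdot> (history X \<cdot> (cons (strategy X) \<cdot> y \<cdot> \<alpha>) \<cdot> s \<cdot> (Con SuccC \<cdot> n)))"
      using that by (intro play_eq) simp_all
    also have "\<dots> = cls \<Delta> \<Gamma> (\<alpha> \<cdot> n \<cdot> (history X \<cdot> \<alpha> \<cdot> (Con (SnocC X) \<cdot> s \<cdot> (y \<cdot> s)) \<cdot> n))"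
      using history_cons[of \<Delta> y X \<alpha> s n \<Gamma>] cons_succ[of \<Delta> y "strategy X" \<alpha> n \<Gamma>] that
      by (simp add: cls_App)
    also have "\<dots> = cls \<Delta> \<Gamma> (play X \<cdot> (Con (SnocC X) \<cdot> s \<cdot> (y \<cdot> s)) \<cdot> \<alpha> \<cdot> n)"
      using that by (intro play_eq[symmetric]) simp_all
    also have "\<dots> = cls \<Delta> \<Gamma> (?b y \<alpha> s (Con SuccC \<cdot> n))"
      using that by (intro cons_succ[symmetric]) simp_all
    finally show ?thesis .
  qed
  have pointwise: "cls \<Delta> \<Gamma> (?a y \<alpha> s n) = cls \<Delta> \<Gamma> (?b y \<alpha> s n)"
    if "has_ty \<Delta> y (strategy X)" "has_ty \<Delta> \<alpha> (NatT \<rightarrow> strategy X)" "has_ty \<Delta> s (SeqT X)"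
      "has_ty \<Delta> n NatT" for \<Delta> \<Gamma> y \<alpha> s n
    using nat_induct_eq[of \<Delta> "?a (ren Suc y) (ren Suc \<alpha>) (ren Suc s) (Var 0)" X
        "?b (ren Suc y) (ren Suc \<alpha>) (ren Suc s) (Var 0)" n \<Gamma>]
      zero[of \<Delta> y \<alpha> s \<Gamma>] succ[of "NatT # \<Delta>" "ren Suc y" "ren Suc \<alpha>" "ren Suc s" "Var 0"] that
    by simp
  show ?thesis
    by (rule cls_ext[of _ _ NatT X])
      (use pointwise[of "NatT # \<Delta>" "ren Suc y" "ren Suc \<alpha>" "ren Suc s" "Var 0" "lift ` \<Gamma>"]
        assms in simp_all)
qed

lemma play_zero:
  assumes "has_ty \<Delta> s (SeqT X)"
  shows "cls \<Delta> \<Gamma> (play X \<cdot> s \<cdot> zero (NatT \<rightarrow> strategy X)) = cls \<Delta> \<Gamma> (zero (NatT \<rightarrow> X))"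
proof (rule cls_ext[of _ _ NatT X])
  let ?\<Delta> = "NatT # \<Delta>" and ?\<Gamma> = "lift ` \<Gamma>" and ?z = "zero (NatT \<rightarrow> strategy X)"
  let ?h = "history X \<cdot> ?z \<cdot> ren Suc s \<cdot> Var 0"
  show "cls ?\<Delta> ?\<Gamma> (ren Suc (play X \<cdot> s \<cdot> ?z) \<cdot> Var 0) = cls ?\<Delta> ?\<Gamma> (ren Suc (zero (NatT \<rightarrow> X)) \<cdot> Var 0)"
    using play_eq[of ?\<Delta> "ren Suc s" X ?z "Var 0" ?\<Gamma>]
      cls_beta_closed[of "zero X" "[NatT, SeqT X]" X ?\<Delta> "[Var 0, ?h]" ?\<Gamma>]
      cls_beta_closed[of "zero X" "[NatT]" X ?\<Delta> "[Var 0]" ?\<Gamma>] assms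
    by simp
qed (use assms in simp_all)

lemma outcome_zero:
  assumes "has_ty \<Delta> q ((NatT \<rightarrow> X) \<rightarrow> R)" "has_ty \<Delta> s (SeqT X)"
  shows "cls \<Delta> \<Gamma> (outcome X R \<cdot> q \<cdot> s \<cdot> zero (NatT \<rightarrow> strategy X)) = cls \<Delta> \<Gamma> (q \<cdot> zero (NatT \<rightarrow> X))"
  using outcome_eq[of \<Delta> q X R s "zero (NatT \<rightarrow> strategy X)" \<Gamma>] play_zero[of \<Delta> s X \<Gamma>] assms
  by (simp add: cls_App)

lemma after_outcome:
  assumes "has_ty \<Delta> q ((NatT \<rightarrow> X) \<rightarrow> R)" "has_ty \<Delta> s (SeqT X)" "has_ty \<Delta> y (strategy X)"
  shows "cls \<Delta> \<Gamma> (after (strategy X) R \<cdot> (outcome X R \<cdot> q \<cdot> s) \<cdot> y)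
    = cls \<Delta> \<Gamma> (outcome X R \<cdot> (after X R \<cdot> q \<cdot> (y \<cdot> s)) \<cdot> (Con (SnocC X) \<cdot> s \<cdot> (y \<cdot> s)))"
proof -
  have pointwise: "cls \<Delta> \<Gamma> (after (strategy X) R \<cdot> (outcome X R \<cdot> q \<cdot> s) \<cdot> y \<cdot> \<alpha>)
      = cls \<Delta> \<Gamma> (outcome X R \<cdot> (after X R \<cdot> q \<cdot> (y \<cdot> s)) \<cdot> (Con (SnocC X) \<cdot> s \<cdot> (y \<cdot> s)) \<cdot> \<alpha>)"
    if "has_ty \<Delta> q ((NatT \<rightarrow> X) \<rightarrow> R)" "has_ty \<Delta> s (SeqT X)" "has_ty \<Delta> y (strategy X)"
      "has_ty \<Delta> \<alpha> (NatT \<rightarrow> strategy X)" for \<Delta> \<Gamma> q s y \<alpha>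
    using after_eq[of \<Delta> "outcome X R \<cdot> q \<cdot> s" "strategy X" R y \<alpha> \<Gamma>]
      outcome_eq[of \<Delta> q X R s "cons (strategy X) \<cdot> y \<cdot> \<alpha>" \<Gamma>]
      play_cons[of \<Delta> y X \<alpha> s \<Gamma>]
      outcome_eq[of \<Delta> "after X R \<cdot> q \<cdot> (y \<cdot> s)" X R "Con (SnocC X) \<cdot> s \<cdot> (y \<cdot> s)" \<alpha> \<Gamma>]
      after_eq[of \<Delta> q X R "y \<cdot> s" "play X \<cdot> (Con (SnocC X) \<cdot> s \<cdot> (y \<cdot> s)) \<cdot> \<alpha>" \<Gamma>] that
    by (simp add: cls_App)
  show ?thesis
    by (rule cls_ext[of _ _ "NatT \<rightarrow> strategy X" R])
      (use pointwise[of "(NatT \<rightarrow> strategy X) # \<Delta>" "ren Suc q" "ren Suc s" "ren Suc y" "Var 0" "lift ` \<Gamma>"]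
        assms in simp_all)
qed

section \<open>The dependent product from the simple one\<close>

text \<open>The argument of the selection function \<open>e \<cdot> n\<close> in the defining equation of \<open>eps\<close>.\<close>

definition continuation :: "ty \<Rightarrow> ty \<Rightarrow> trm \<Rightarrow> trm \<Rightarrow> trm \<Rightarrow> trm \<Rightarrow> trm \<Rightarrow> trm" where
  "continuation X R F l n e q = Lam X (after X R \<cdot> ren Suc q \<cdot> Var 0
    \<cdot> (ren Suc F \<cdot> ren Suc l \<cdot> (Con SuccC \<cdot> ren Suc n) \<cdot> ren Suc e \<cdot> (after X R \<cdot> ren Suc q \<cdot> Var 0)))"

lemma ren_continuation [simp]:
  "ren Suc (continuation X R F l n e q)
    = continuation X R (ren Suc F) (ren Suc l) (ren Suc n) (ren Suc e) (ren Suc q)"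
  by (simp add: continuation_def)

definition eps_asm :: "ty \<Rightarrow> ty \<Rightarrow> trm \<Rightarrow> fm" where
  "eps_asm X R F = fsub (\<lambda>i. F) (eps_eq X R)"

lemma lift_eps_asm: "lift (eps_asm X R F) = eps_asm X R (ren Suc F)"
  by (simp add: eps_asm_def lift_fsub)

locale typed_args =
  fixes \<Delta> :: "ty list" and X R :: ty and F l n e q :: trm
  assumes F: "infer F \<Delta> = Some (eps_ty X R)"
    and l: "infer l \<Delta> = Some (R \<rightarrow> NatT)"
    and n: "infer n \<Delta> = Some NatT"
    and e: "infer e \<Delta> = Some (NatT \<rightarrow> J R X)"
    and q: "infer q \<Delta> = Some ((NatT \<rightarrow> X) \<rightarrow> R)"
begin

lemma infer_continuation: "infer (continuation X R F l n e q) \<Delta> = Some (X \<rightarrow> R)"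
  using F l n e q by (simp add: continuation_def eps_ty_def)

lemma continuation_App:
  assumes "has_ty \<Delta> x X"
  shows "cls \<Delta> \<Gamma> (continuation X R F l n e q \<cdot> x)
    = cls \<Delta> \<Gamma> (after X R \<cdot> q \<cdot> x \<cdot> (F \<cdot> l \<cdot> (Con SuccC \<cdot> n) \<cdot> e \<cdot> (after X R \<cdot> q \<cdot> x)))"
  using cls_beta[of X \<Delta> "after X R \<cdot> ren Suc q \<cdot> Var 0 \<cdot> (ren Suc F \<cdot> ren Suc l \<cdot> (Con SuccC \<cdot> ren Suc n)
      \<cdot> ren Suc e \<cdot> (after X R \<cdot> ren Suc q \<cdot> Var 0))" R x \<Gamma>] assms F l n e q
  by (simp add: continuation_def eps_ty_def)

lemma eps_eq_instance:
  assumes "eps_asm X R F \<in> \<Gamma>"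
  shows "cls \<Delta> \<Gamma> (F \<cdot> l \<cdot> n \<cdot> e \<cdot> q)
    = cls \<Delta> \<Gamma> (Con (Cond (NatT \<rightarrow> X)) \<cdot> (lessb \<cdot> (l \<cdot> (q \<cdot> zero (NatT \<rightarrow> X))) \<cdot> n)
        \<cdot> zero (NatT \<rightarrow> X)
        \<cdot> (cons X \<cdot> (e \<cdot> n \<cdot> continuation X R F l n e q)
          \<cdot> (F \<cdot> l \<cdot> (Con SuccC \<cdot> n) \<cdot> e \<cdot> (after X R \<cdot> q \<cdot> (e \<cdot> n \<cdot> continuation X R F l n e q)))))"
proof (rule cls_eqI)
  have "wff [eps_ty X R] (eps_eq X R)"
    by (simp add: eps_eq_def eps_ty_def J_def Let_def)
  from wff_fsub[OF this] have "wff \<Delta> (eps_asm X R F)"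
    unfolding eps_asm_def using F by simp
  with assms have "prv HA_omega \<Delta> \<Gamma> (eps_asm X R F)"
    by (rule prv.asm)
  then have "prv HA_omega \<Delta> \<Gamma> (fsub (\<lambda>i. F) (close
      [(NatT \<rightarrow> X) \<rightarrow> R, NatT \<rightarrow> J R X, NatT, R \<rightarrow> NatT]
      (let c = Var 1 \<cdot> Var 2 \<cdot> continuation X R (Var 4) (Var 3) (Var 2) (Var 1) (Var 0)
       in Eq (NatT \<rightarrow> X) (Var 4 \<cdot> Var 3 \<cdot> Var 2 \<cdot> Var 1 \<cdot> Var 0)
            (Con (Cond (NatT \<rightarrow> X)) \<cdot> (lessb \<cdot> (Var 3 \<cdot> (Var 0 \<cdot> zero (NatT \<rightarrow> X))) \<cdot> Var 2)
              \<cdot> zero (NatT \<rightarrow> X)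
              \<cdot> (cons X \<cdot> c \<cdot> (Var 4 \<cdot> Var 3 \<cdot> (Con SuccC \<cdot> Var 2) \<cdot> Var 1 \<cdot> (after X R \<cdot> Var 0 \<cdot> c)))))))"
    by (simp add: eps_asm_def eps_eq_def close_def continuation_def Let_def)
  from prv_close_instance[OF this, of "case_nat q (case_nat e (case_nat n (case_nat l (\<lambda>i. F))))"]
  show "prv HA_omega \<Delta> \<Gamma> (Eq (NatT \<rightarrow> X) (F \<cdot> l \<cdot> n \<cdot> e \<cdot> q)
      (Con (Cond (NatT \<rightarrow> X)) \<cdot> (lessb \<cdot> (l \<cdot> (q \<cdot> zero (NatT \<rightarrow> X))) \<cdot> n)
        \<cdot> zero (NatT \<rightarrow> X)
        \<cdot> (cons X \<cdot> (e \<cdot> n \<cdot> continuation X R F l n e q)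
          \<cdot> (F \<cdot> l \<cdot> (Con SuccC \<cdot> n) \<cdot> e \<cdot> (after X R \<cdot> q \<cdot> (e \<cdot> n \<cdot> continuation X R F l n e q))))))"
    using l n e q by (simp add: Let_def continuation_def)
qed

end

locale EPS_args =
  fixes \<Delta> :: "ty list" and X R :: ty and F l s e q :: trm
  assumes F: "infer F \<Delta> = Some (eps_ty (strategy X) R)"
    and l: "infer l \<Delta> = Some (R \<rightarrow> NatT)"
    and s: "infer s \<Delta> = Some (SeqT X)"
    and e: "infer e \<Delta> = Some (SeqT X \<rightarrow> J R X)"
    and q: "infer q \<Delta> = Some ((NatT \<rightarrow> X) \<rightarrow> R)"
begin

sublocale simple: typed_args \<Delta> "strategy X" R F l "len X \<cdot> s" "select_strategy X R \<cdot> e" "outcome X R \<cdot> q \<cdot> s"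
  using F l s e q by unfold_locales simp_all

abbreviation "P \<equiv> continuation (strategy X) R F l (len X \<cdot> s) (select_strategy X R \<cdot> e) (outcome X R \<cdot> q \<cdot> s)"

abbreviation "after_EPS x \<equiv>
  EPS_of_eps X R \<cdot> F \<cdot> l \<cdot> (Con (SnocC X) \<cdot> s \<cdot> x) \<cdot> e \<cdot> (after X R \<cdot> q \<cdot> x)"

lemma play_after_EPS:
  assumes "has_ty \<Delta> y (strategy X)" "has_ty \<Delta> x X" "cls \<Delta> \<Gamma> (y \<cdot> s) = cls \<Delta> \<Gamma> x"
  shows "cls \<Delta> \<Gamma> (play X \<cdot> (Con (SnocC X) \<cdot> s \<cdot> x)
      \<cdot> (F \<cdot> l \<cdot> (Con SuccC \<cdot> (len X \<cdot> s)) \<cdot> (select_strategy X R \<cdot> e)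
        \<cdot> (after (strategy X) R \<cdot> (outcome X R \<cdot> q \<cdot> s) \<cdot> y)))
    = cls \<Delta> \<Gamma> (after_EPS x)"
  using EPS_of_eps_eq[of \<Delta> F X R l "Con (SnocC X) \<cdot> s \<cdot> x" e "after X R \<cdot> q \<cdot> x" \<Gamma>]
    after_outcome[of \<Delta> q X R s y \<Gamma>] len_snoc[of \<Delta> s X x \<Gamma>] assms F l s e q
  by (simp add: cls_App)

lemma continuation_constant:
  assumes "has_ty \<Delta> x X"
  shows "cls \<Delta> \<Gamma> (P \<cdot> (constant_strategy X \<cdot> x)) = cls \<Delta> \<Gamma> (after X R \<cdot> q \<cdot> x \<cdot> after_EPS x)"
proof -
  let ?y = "constant_strategy X \<cdot> x"
  let ?\<beta> = "F \<cdot> l \<cdot> (Con SuccC \<cdot> (len X \<cdot> s)) \<cdot> (select_strategy X R \<cdot> e)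
    \<cdot> (after (strategy X) R \<cdot> (outcome X R \<cdot> q \<cdot> s) \<cdot> ?y)"
  have y: "cls \<Delta> \<Gamma> (?y \<cdot> s) = cls \<Delta> \<Gamma> x"
    using assms s by (intro constant_strategy_eq) simp_all
  have \<beta>: "has_ty \<Delta> ?\<beta> (NatT \<rightarrow> strategy X)"
    using assms F l s e q by (simp add: eps_ty_def)
  have "cls \<Delta> \<Gamma> (P \<cdot> ?y) = cls \<Delta> \<Gamma> (after (strategy X) R \<cdot> (outcome X R \<cdot> q \<cdot> s) \<cdot> ?y \<cdot> ?\<beta>)"
    using assms by (intro simple.continuation_App) simp
  also have "\<dots> = cls \<Delta> \<Gamma> (outcome X R \<cdot> (after X R \<cdot> q \<cdot> x) \<cdot> (Con (SnocC X) \<cdot> s \<cdot> x) \<cdot> ?\<beta>)"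
    using after_outcome[of \<Delta> q X R s ?y \<Gamma>] y assms s q by (simp add: cls_App)
  also have "\<dots> = cls \<Delta> \<Gamma> (after X R \<cdot> q \<cdot> x \<cdot> (play X \<cdot> (Con (SnocC X) \<cdot> s \<cdot> x) \<cdot> ?\<beta>))"
    using assms s q \<beta> by (intro outcome_eq) simp_all
  also have "\<dots> = cls \<Delta> \<Gamma> (after X R \<cdot> q \<cdot> x \<cdot> after_EPS x)"
    using play_after_EPS[OF _ assms y] assms by (simp add: cls_App)
  finally show ?thesis .
qed

end

lemma EPS_of_eps_recursion:
  fixes X R :: ty and F l s e q :: trm
  defines "c \<equiv> e \<cdot> s \<cdot> Lam X (after X R \<cdot> ren Suc q \<cdot> Var 0 \<cdot> (EPS_of_eps X R \<cdot> ren Suc F \<cdot> ren Suc l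
    \<cdot> (Con (SnocC X) \<cdot> ren Suc s \<cdot> Var 0) \<cdot> ren Suc e \<cdot> (after X R \<cdot> ren Suc q \<cdot> Var 0)))"
  assumes args: "EPS_args \<Delta> X R F l s e q" and asm: "eps_asm (strategy X) R F \<in> \<Gamma>"
  shows "cls \<Delta> \<Gamma> (EPS_of_eps X R \<cdot> F \<cdot> l \<cdot> s \<cdot> e \<cdot> q)
    = cls \<Delta> \<Gamma> (Con (Cond (NatT \<rightarrow> X)) \<cdot> (lessb \<cdot> (l \<cdot> (q \<cdot> zero (NatT \<rightarrow> X))) \<cdot> (len X \<cdot> s))
        \<cdot> zero (NatT \<rightarrow> X)
        \<cdot> (cons X \<cdot> c \<cdot> (EPS_of_eps X R \<cdot> F \<cdot> l \<cdot> (Con (SnocC X) \<cdot> s \<cdot> c) \<cdot> e \<cdot> (after X R \<cdot> q \<cdot> c))))"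
proof -
  interpret EPS_args \<Delta> X R F l s e q by (rule args)
  interpret bound: EPS_args "X # \<Delta>" X R "ren Suc F" "ren Suc l" "ren Suc s" "ren Suc e" "ren Suc q"
    using F l s e q by unfold_locales simp_all
  let ?Y = "strategy X"
  let ?e = "select_strategy X R \<cdot> e" and ?q = "outcome X R \<cdot> q \<cdot> s" and ?n = "len X \<cdot> s"
  let ?y = "?e \<cdot> ?n \<cdot> P"
  let ?\<beta> = "F \<cdot> l \<cdot> (Con SuccC \<cdot> ?n) \<cdot> ?e \<cdot> (after ?Y R \<cdot> ?q \<cdot> ?y)"
  let ?b = "lessb \<cdot> (l \<cdot> (?q \<cdot> zero (NatT \<rightarrow> ?Y))) \<cdot> ?n"
  note P = simple.infer_continuation
  have y: "has_ty \<Delta> ?y ?Y"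
    using s e P by (simp add: J_def)
  have \<beta>: "has_ty \<Delta> ?\<beta> (NatT \<rightarrow> ?Y)"
    using y F l s e q by (simp add: eps_ty_def)
  have c: "has_ty \<Delta> c X"
    using F l s e q by (simp add: c_def J_def EPS_ty_def)
  have "cls \<Delta> \<Gamma> (?y \<cdot> s) = cls \<Delta> \<Gamma> (e \<cdot> s \<cdot> Lam X (ren Suc P \<cdot> (constant_strategy X \<cdot> Var 0)))"
    using s e P by (intro select_strategy_eq) simp_all
  also have "\<dots> = cls \<Delta> \<Gamma> c"
  proof -
    have "cls \<Delta> \<Gamma> (Lam X (ren Suc P \<cdot> (constant_strategy X \<cdot> Var 0))) = cls \<Delta> \<Gamma> (Lam X
        (after X R \<cdot> ren Suc q \<cdot> Var 0 \<cdot> bound.after_EPS (Var 0)))"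
    proof (rule cls_xi[of _ _ _ R])
      show "cls (X # \<Delta>) (lift ` \<Gamma>) (ren Suc P \<cdot> (constant_strategy X \<cdot> Var 0))
          = cls (X # \<Delta>) (lift ` \<Gamma>) (after X R \<cdot> ren Suc q \<cdot> Var 0 \<cdot> bound.after_EPS (Var 0))"
        using bound.continuation_constant[of "Var 0" "lift ` \<Gamma>"] by simp
    qed (use F l s e q P bound.simple.infer_continuation in \<open>simp_all add: EPS_ty_def\<close>)
    then show ?thesis by (simp add: c_def cls_App)
  qed
  finally have ys: "cls \<Delta> \<Gamma> (?y \<cdot> s) = cls \<Delta> \<Gamma> c" .
  have b: "cls \<Delta> \<Gamma> ?b = cls \<Delta> \<Gamma> (lessb \<cdot> (l \<cdot> (q \<cdot> zero (NatT \<rightarrow> X))) \<cdot> ?n)"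
    using outcome_zero[of \<Delta> q X R s \<Gamma>] s q by (simp add: cls_App)
  have "cls \<Delta> \<Gamma> (EPS_of_eps X R \<cdot> F \<cdot> l \<cdot> s \<cdot> e \<cdot> q) = cls \<Delta> \<Gamma> (play X \<cdot> s \<cdot> (F \<cdot> l \<cdot> ?n \<cdot> ?e \<cdot> ?q))"
    using F l s e q by (intro EPS_of_eps_eq) simp_all
  also have "\<dots> = cls \<Delta> \<Gamma> (play X \<cdot> s
      \<cdot> (Con (Cond (NatT \<rightarrow> ?Y)) \<cdot> ?b \<cdot> zero (NatT \<rightarrow> ?Y) \<cdot> (cons ?Y \<cdot> ?y \<cdot> ?\<beta>)))"
    using simple.eps_eq_instance[OF asm] by (simp only: cls_App)
  also have "\<dots> = cls \<Delta> \<Gamma> (Con (Cond (NatT \<rightarrow> X)) \<cdot> ?b \<cdot> (play X \<cdot> s \<cdot> zero (NatT \<rightarrow> ?Y))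
      \<cdot> (play X \<cdot> s \<cdot> (cons ?Y \<cdot> ?y \<cdot> ?\<beta>)))"
    using F l s e q y \<beta> by (intro cond_App) simp_all
  also have "\<dots> = cls \<Delta> \<Gamma> (Con (Cond (NatT \<rightarrow> X)) \<cdot> (lessb \<cdot> (l \<cdot> (q \<cdot> zero (NatT \<rightarrow> X))) \<cdot> ?n)
        \<cdot> zero (NatT \<rightarrow> X) \<cdot> (cons X \<cdot> c \<cdot> after_EPS c))"
  proof -
    have "cls \<Delta> \<Gamma> (play X \<cdot> s \<cdot> (cons ?Y \<cdot> ?y \<cdot> ?\<beta>))
        = cls \<Delta> \<Gamma> (cons X \<cdot> (?y \<cdot> s) \<cdot> (play X \<cdot> (Con (SnocC X) \<cdot> s \<cdot> (?y \<cdot> s)) \<cdot> ?\<beta>))"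
      using s y \<beta> by (intro play_cons) simp_all
    also have "\<dots> = cls \<Delta> \<Gamma> (cons X \<cdot> c \<cdot> (play X \<cdot> (Con (SnocC X) \<cdot> s \<cdot> c) \<cdot> ?\<beta>))"
      using ys by (simp only: cls_App)
    also have "\<dots> = cls \<Delta> \<Gamma> (cons X \<cdot> c \<cdot> after_EPS c)"
      using play_after_EPS[OF y c ys] by (simp only: cls_App)
    finally have step: "cls \<Delta> \<Gamma> (play X \<cdot> s \<cdot> (cons ?Y \<cdot> ?y \<cdot> ?\<beta>)) = cls \<Delta> \<Gamma> (cons X \<cdot> c \<cdot> after_EPS c)" .
    have zero: "cls \<Delta> \<Gamma> (play X \<cdot> s \<cdot> zero (NatT \<rightarrow> ?Y)) = cls \<Delta> \<Gamma> (zero (NatT \<rightarrow> X))"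
      using s by (intro play_zero) simp
    show ?thesis
      by (rule cls_App_eq[OF cls_App_eq[OF cls_App_eq[OF HOL.refl b] zero] step])
  qed
  finally show ?thesis .
qed

lemma eps_asm_Var: "eps_asm X R (Var 0) = eps_eq X R"
  by (simp add: eps_asm_def eps_eq_def Let_def)

theorem theorem3p13:
  shows "T_definable_from HA_omega eps EPS"
  unfolding T_definable_from_def
proof (rule HOL.allI)
  fix XR :: "ty \<times> ty"
  obtain X R where XR: "XR = (X, R)" by fastforce
  let ?\<Delta> = "[(NatT \<rightarrow> X) \<rightarrow> R, SeqT X \<rightarrow> J R X, SeqT X, R \<rightarrow> NatT, eps_ty (strategy X) R]"
  let ?\<Gamma> = "(`) lift ((`) lift ((`) lift ((`) lift {eps_eq (strategy X) R})))"
  have asm: "eps_asm (strategy X) R (Var 4) \<in> ?\<Gamma>"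
    by (simp add: eps_asm_Var[symmetric] lift_eps_asm numeral_eq_Suc)
  have args: "EPS_args ?\<Delta> X R (Var 4) (Var 3) (Var 2) (Var 1) (Var 0)"
    by unfold_locales simp_all
  have "has_ty ?\<Delta> (EPS_of_eps X R \<cdot> Var 4 \<cdot> Var 3 \<cdot> Var 2 \<cdot> Var 1 \<cdot> Var 0) (NatT \<rightarrow> X)"
    by (simp add: EPS_ty_def)
  from prv.allI[OF prv.allI[OF prv.allI[OF prv.allI[OF
    cls_eqD[OF EPS_of_eps_recursion[OF args asm] this]]]]]
  have "prv HA_omega [eps_ty (strategy X) R] {eps_eq (strategy X) R}
      (fsub (inst (EPS_of_eps X R \<cdot> Var 0)) (EPS_eq X R))"
    by (simp add: EPS_eq_def Let_def numeral_eq_Suc)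
  then show "\<exists>p t. has_ty [] t (fst (eps p) \<rightarrow> fst (EPS XR))
      \<and> prv HA_omega [fst (eps p)] {snd (eps p)} (fsub (inst (t \<cdot> Var 0)) (snd (EPS XR)))"
    by (intro HOL.exI[of _ "(strategy X, R)"] HOL.exI[of _ "EPS_of_eps X R"]) (simp add: XR eps_def EPS_def)
qed

end
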